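(* Let $r\ge 2$ be a fixed integer and let $F_r$ be the free group of rank $r$. The probability that a random subgroup of $F_r$ of size $n$ (chosen uniformly among the finitely many subgroups of size $n$) is pure is $O(n^{-r/2})$ as $n\to\infty$.
   Context: Let $A$ be an alphabet with $r$ letters and $F_r=F(A)$. An $A$-graph is a pair $\Gamma=(V,E)$ with $E\subseteq V\times A\times V$ such that $(u,a,v),(u,a,v')\in E$ implies $v=v'$, and $(u,a,v),(u',a,v)\in E$ implies $u=u'$. It is connected if its underlying undirected graph is connected. A vertex is a leaf if it occurs at most once in the list of triples defining $E$. A pair $(\Gamma,1)$, with $1$ a distinguished vertex of $\Gamma$, is admissible if $\Gamma$ is a finite connected $A$-graph in which no vertex other than $1$ is a leaf. Each finitely generated subgroup $H$ of $F(A)$ corresponds to a unique (up to isomorphism) admissible pair $(\Gamma(H),1)$, its Stallings graph, such that a reduced word $u$ is in $H$ if and only if $u$ labels a loop at $1$ (an edge $(x,a,y)$ being read from $x$ to $y$ with label $a$ or from $y$ to $x$ with label $a^{-1}$); conversely every admissible pair is the Stallings graph of a unique finitely generated subgroup. The size of $H$ is the number of vertices of $\Gamma(H)$; there are finitely many subgroups of each size. A random subgroup of size $n$ is taken with respect to the uniform distribution on subgroups of size $n$ (the graph-based distribution). A subgroup $H$ is pure if, for all $x\in F_r$ and all integers $m\ne0$, $x^m\in H$ implies $x\in H$. *)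

theory Defs
  imports "HOL-Algebra.Generated_Groups" "HOL-Probability.Probability_Mass_Function"
    "HOL-Library.Landau_Symbols"
begin

section \<open>The free group on an alphabet\<close>

text \<open>The pair \<open>(a, True)\<close> stands for the letter \<open>a\<close> and \<open>(a, False)\<close> for its formal
  inverse. Elements of the free group are reduced words.\<close>

type_synonym 'a word = "('a \<times> bool) list"

fun inv_letter :: "'a \<times> bool \<Rightarrow> 'a \<times> bool" where
  "inv_letter (a, b) = (a, \<not> b)"

fun reduced :: "'a word \<Rightarrow> bool" where
  "reduced [] \<longleftrightarrow> True"
| "reduced [x] \<longleftrightarrow> True"
| "reduced (x # y # w) \<longleftrightarrow> y \<noteq> inv_letter x \<and> reduced (y # w)"

fun push :: "'a \<times> bool \<Rightarrow> 'a word \<Rightarrow> 'a word" where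
  "push x [] = [x]"
| "push x (y # w) = (if y = inv_letter x then w else x # y # w)"

text \<open>For reduced words \<open>u\<close> and \<open>v\<close>, \<open>foldr push u v\<close> is the reduced form of \<open>u @ v\<close>.\<close>

definition free_group :: "'a set \<Rightarrow> 'a word monoid" where
  "free_group A =
    \<lparr>carrier = {w. reduced w \<and> fst ` set w \<subseteq> A},
     monoid.mult = (\<lambda>u v. foldr push u v),
     one = []\<rparr>"

lemma inv_letter_invol [simp]: "inv_letter (inv_letter x) = x"
  by (cases x) auto

lemma fst_inv_letter [simp]: "fst (inv_letter x) = fst x"
  by (cases x) auto

lemma inv_letter_neq [simp]: "inv_letter x \<noteq> x" "x \<noteq> inv_letter x"
  by (cases x; auto)+

lemma reduced_Cons: "reduced (x # w) \<longleftrightarrow> reduced w \<and> (w = [] \<or> hd w \<noteq> inv_letter x)"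
  by (cases w) auto

lemma reduced_push: "reduced w \<Longrightarrow> reduced (push x w)"
  by (cases w) (auto simp: reduced_Cons)

lemma reduced_foldr_push: "reduced v \<Longrightarrow> reduced (foldr push u v)"
  by (induction u) (auto simp: reduced_push)

lemma push_inv_letter: "reduced w \<Longrightarrow> push x (push (inv_letter x) w) = w"
  by (cases w; cases "tl w") auto

lemma foldr_push_push:
  assumes "reduced w"
  shows "foldr push (push x u) w = push x (foldr push u w)"
proof (cases u)
  case (Cons y v)
  have "push x (push (inv_letter x) (foldr push v w)) = foldr push v w"
    by (intro push_inv_letter reduced_foldr_push assms)
  then show ?thesis using Cons by auto
qed simp

lemma foldr_push_assoc:
  assumes "reduced w"
  shows "foldr push (foldr push u v) w = foldr push u (foldr push v w)"
  by (induction u) (auto simp: foldr_push_push assms)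

lemma foldr_push_Nil: "reduced u \<Longrightarrow> foldr push u [] = u"
proof (induction u)
  case (Cons x u)
  then show ?case by (cases u) (auto simp: reduced_Cons)
qed simp

lemma letters_foldr_push: "set (foldr push u v) \<subseteq> set u \<union> set v"
proof (induction u)
  case (Cons x u)
  have "set (push x w) \<subseteq> insert x (set w)" for w
    by (cases w) auto
  with Cons show ?case by fastforce
qed simp

lemma foldr_push_append_inv:
  "reduced v \<Longrightarrow> foldr push (rev (map inv_letter u)) (foldr push u v) = v"
proof (induction u arbitrary: v)
  case (Cons x u)
  have "push (inv_letter x) (push x (foldr push u v)) = foldr push u v"
    using push_inv_letter[of "foldr push u v" "inv_letter x"] reduced_foldr_push[OF Cons.prems]
    by simp
  with Cons show ?case by simp
qed simp

lemma group_free_group: "group (free_group A)"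
proof (rule groupI)
  fix x y assume "x \<in> carrier (free_group A)" "y \<in> carrier (free_group A)"
  then show "x \<otimes>\<^bsub>free_group A\<^esub> y \<in> carrier (free_group A)"
    using letters_foldr_push[of x y] by (fastforce simp: free_group_def reduced_foldr_push)
next
  fix x assume x: "x \<in> carrier (free_group A)"
  define y where "y = foldr push (rev (map inv_letter x)) []"
  have "set y \<subseteq> inv_letter ` set x"
    using letters_foldr_push[of "rev (map inv_letter x)" "[]"] by (simp add: y_def)
  with x have "fst ` set y \<subseteq> A"
    by (fastforce simp: free_group_def)
  then have "y \<in> carrier (free_group A)"
    by (simp add: free_group_def y_def reduced_foldr_push)
  moreover have "foldr push y x = []"
  proof -
    have "foldr push y x = foldr push (rev (map inv_letter x)) (foldr push [] x)"
      unfolding y_def using x by (intro foldr_push_assoc) (simp add: free_group_def)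
    also have "\<dots> = foldr push (rev (map inv_letter x)) (foldr push x [])"
      using x by (simp add: free_group_def foldr_push_Nil)
    also have "\<dots> = []" by (simp add: foldr_push_append_inv)
    finally show ?thesis .
  qed
  ultimately show "\<exists>y\<in>carrier (free_group A). y \<otimes>\<^bsub>free_group A\<^esub> x = \<one>\<^bsub>free_group A\<^esub>"
    by (intro bexI[of _ y]) (simp_all add: free_group_def)
qed (auto simp: free_group_def foldr_push_assoc)

definition finitely_generated_subgroup :: "'a word set \<Rightarrow> 'a set \<Rightarrow> bool" where
  "finitely_generated_subgroup H A \<longleftrightarrow> subgroup H (free_group A) \<and>
    (\<exists>S. finite S \<and> S \<subseteq> carrier (free_group A) \<and> H = generate (free_group A) S)"

definition pure_subgroup :: "'a word set \<Rightarrow> 'a set \<Rightarrow> bool" where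
  "pure_subgroup H A \<longleftrightarrow> subgroup H (free_group A) \<and>
    (\<forall>x\<in>carrier (free_group A). \<forall>m::int.
      m \<noteq> 0 \<longrightarrow> x [^]\<^bsub>free_group A\<^esub> m \<in> H \<longrightarrow> x \<in> H)"

section \<open>Stallings graphs\<close>

type_synonym ('v, 'a) edges = "('v \<times> 'a \<times> 'v) set"

definition A_graph :: "'a set \<Rightarrow> 'v set \<Rightarrow> ('v, 'a) edges \<Rightarrow> bool" where
  "A_graph A V E \<longleftrightarrow> E \<subseteq> V \<times> A \<times> V \<and>
    (\<forall>u a v v'. (u, a, v) \<in> E \<longrightarrow> (u, a, v') \<in> E \<longrightarrow> v = v') \<and>
    (\<forall>u u' a v. (u, a, v) \<in> E \<longrightarrow> (u', a, v) \<in> E \<longrightarrow> u = u')"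

definition connected_graph :: "'v set \<Rightarrow> ('v, 'a) edges \<Rightarrow> bool" where
  "connected_graph V E \<longleftrightarrow>
    (\<forall>u\<in>V. \<forall>v\<in>V. (u, v) \<in> {(x, y). \<exists>a. (x, a, y) \<in> E \<or> (y, a, x) \<in> E}\<^sup>*)"

text \<open>Occurrences as a source and as a target are counted separately, so a loop contributes two
  occurrences of its vertex.\<close>

definition leaf :: "('v, 'a) edges \<Rightarrow> 'v \<Rightarrow> bool" where
  "leaf E v \<longleftrightarrow> card {(x, a, y) \<in> E. x = v} + card {(x, a, y) \<in> E. y = v} \<le> 1"

definition admissible :: "'a set \<Rightarrow> 'v set \<Rightarrow> ('v, 'a) edges \<Rightarrow> 'v \<Rightarrow> bool" where
  "admissible A V E p \<longleftrightarrow> finite V \<and> p \<in> V \<and> A_graph A V E \<and> connected_graph V E \<and>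
    (\<forall>v\<in>V. v \<noteq> p \<longrightarrow> \<not> leaf E v)"

fun read_letter :: "('v, 'a) edges \<Rightarrow> 'v \<Rightarrow> 'a \<times> bool \<Rightarrow> 'v \<Rightarrow> bool" where
  "read_letter E x (a, b) y \<longleftrightarrow> (if b then (x, a, y) \<in> E else (y, a, x) \<in> E)"

fun read_word :: "('v, 'a) edges \<Rightarrow> 'v \<Rightarrow> 'a word \<Rightarrow> 'v \<Rightarrow> bool" where
  "read_word E x [] y \<longleftrightarrow> x = y"
| "read_word E x (l # w) y \<longleftrightarrow> (\<exists>z. read_letter E x l z \<and> read_word E z w y)"

definition stallings_graph ::
    "'a set \<Rightarrow> 'a word set \<Rightarrow> 'v set \<Rightarrow> ('v, 'a) edges \<Rightarrow> 'v \<Rightarrow> bool" where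
  "stallings_graph A H V E p \<longleftrightarrow> admissible A V E p \<and>
    (\<forall>u\<in>carrier (free_group A). u \<in> H \<longleftrightarrow> read_word E p u p)"

text \<open>The Stallings graph is only determined up to isomorphism and is finite, so it loses no
  generality to take its vertices to be natural numbers.\<close>

definition subgroups_of_size :: "'a set \<Rightarrow> nat \<Rightarrow> 'a word set set" where
  "subgroups_of_size A n = {H. finitely_generated_subgroup H A \<and>
    (\<exists>(V :: nat set) E p. stallings_graph A H V E p \<and> card V = n)}"

end

theory Submission imports Defs begin

text \<open>An \<open>A\<close>-graph on \<open>n\<close> labelled vertices is the same thing as a family of \<open>r\<close> partial injections of an
\<open>n\<close>-set, one for each letter. The proof compares the families that can come from a pure subgroup with
all families, one letter at a time.

\<^bold>\<open>Purity forbids cycles.\<close> Suppose the edges labelled \<open>a\<close> contain a cycle of length \<open>k\<close> through a vertex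
\<open>x\<close>, and let \<open>u\<close> label a path from the base vertex to \<open>x\<close>. Then \<open>(u a u\<inverse>)\<^sup>k\<close> lies in the subgroup, so by
purity \<open>u a u\<inverse>\<close> does, and this forces \<open>a\<close> to label a loop at \<open>x\<close>. Hence the cycles of each letter of a
pure subgroup are fixed points (\<open>pure_no_long_cycle\<close>).

\<^bold>\<open>Partial injections with only fixed points as cycles are rare.\<close> Let \<open>k\<close> be the number of points outside the
domain of a partial injection of an \<open>n\<close>-set; equivalently, the number of its maximal paths. An edge
can be added to it in \<open>k\<^sup>2\<close> ways, but to an acyclic one in at most \<open>k (k - 1)\<close> ways that keep
it acyclic, since each path must not be closed up. Counting pairs of a partial injection and one of its
edges, it follows by induction that among those with \<open>k\<close> paths at most a fraction \<open>k / n\<close> is acyclic.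
The same double count gives \<open>E[k\<^sup>2] \<le> n\<close>, so \<open>E[k] \<le> sqrt n\<close> and at most a fraction
\<open>1 / sqrt n\<close> of all partial injections is acyclic. Allowing \<open>j\<close> fixed points costs a factor \<open>1 / j!\<close>,
altogether at most \<open>e\<close> (\<open>card_only_fixed_cycles\<close>). With \<open>r\<close> letters the proportion is at most
\<open>(e / sqrt n)\<^sup>r\<close>, which is the order claimed.

\<^bold>\<open>Most families are Stallings graphs.\<close> It remains to see that a positive proportion of all families is
admissible. Failure to be admissible is visible on any two letters: a leaf is isolated for one of them and
lacks an incoming or outgoing edge for the other, and a disconnected graph has a set of at most half of the
vertices that both letters respect. Both events have probability \<open>O(1 / sqrt n)\<close>
(\<open>card_bad_pairs\<close>), so at least half of the families are admissible for large \<open>n\<close>.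

\<^bold>\<open>From labelled graphs to subgroups.\<close> The Stallings graph of a subgroup is unique up to a unique
isomorphism. Every subgroup of size \<open>n\<close> therefore has exactly \<open>(n - 1)!\<close> labelled graphs with base vertex
\<open>0\<close>, and the uniform distribution on subgroups is the image of that on admissible labelled
graphs (\<open>card_labelled_property\<close>).\<close>

section \<open>Reduction of words\<close>

definition inv_word :: "'a word \<Rightarrow> 'a word" where
  "inv_word w = rev (map inv_letter w)"

abbreviation free_reduce :: "'a word \<Rightarrow> 'a word" where
  "free_reduce w \<equiv> foldr push w []"

lemma inv_word_inv_word [simp]: "inv_word (inv_word w) = w"
  by (simp add: inv_word_def rev_map o_def)

lemma fst_set_inv_word [simp]: "fst ` set (inv_word w) = fst ` set w"
  by (auto simp: inv_word_def image_image)

lemma foldr_push_inv_word_left: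
  "reduced v \<Longrightarrow> foldr push (inv_word u) (foldr push u v) = v"
  by (simp add: inv_word_def foldr_push_append_inv)

lemma foldr_push_inv_word_right:
  "reduced v \<Longrightarrow> foldr push u (foldr push (inv_word u) v) = v"
  using foldr_push_inv_word_left[of v "inv_word u"] by simp

lemma foldr_push_free_reduce:
  "reduced v \<Longrightarrow> foldr push (free_reduce u) v = foldr push u v"
  using foldr_push_assoc[of v u "[]"] by simp

lemma reduced_append:
  "reduced (u @ v) \<longleftrightarrow> reduced u \<and> reduced v \<and>
     (u = [] \<or> v = [] \<or> hd v \<noteq> inv_letter (last u))"
  by (induction u rule: reduced.induct) (auto simp: reduced_Cons)

text \<open>Cancellation in a product of two reduced words only happens at their junction, where it removes a
suffix \<open>c\<close> of the first word together with the prefix of the second that is inverse to it.\<close>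

lemma foldr_push_cancel:
  assumes "reduced w" "reduced t"
  shows "\<exists>w1 c t1. w = w1 @ c \<and> t = inv_word c @ t1 \<and> foldr push w t = w1 @ t1"
  using assms(1)
proof (induction w)
  case Nil
  then show ?case by (auto simp: inv_word_def)
next
  case (Cons x w)
  then obtain w1 c t1 where *: "w = w1 @ c" "t = inv_word c @ t1" "foldr push w t = w1 @ t1"
    by (auto simp: reduced_Cons)
  show ?case
  proof (cases w1)
    case Nil
    show ?thesis
    proof (cases "t1 \<noteq> [] \<and> hd t1 = inv_letter x")
      case True
      then obtain t2 where "t1 = inv_letter x # t2" by (cases t1) auto
      with Nil * have "x # w = [] @ (x # c) \<and> t = inv_word (x # c) @ t2 \<and>
          foldr push (x # w) t = [] @ t2"
        by (simp add: inv_word_def)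
      then show ?thesis by blast
    next
      case False
      then have "push x t1 = x # t1" by (cases t1) auto
      with Nil * have "x # w = [x] @ c \<and> t = inv_word c @ t1 \<and> foldr push (x # w) t = [x] @ t1"
        by simp
      then show ?thesis by blast
    qed
  next
    case (Cons y w2)
    with * Cons.prems have "x # w = (x # w1) @ c \<and> t = inv_word c @ t1 \<and>
        foldr push (x # w) t = (x # w1) @ t1"
      by simp
    then show ?thesis using * by blast
  qed
qed

text \<open>A factor no longer than \<open>s\<close> is too short to cancel anything before \<open>s\<close>.\<close>

lemma foldr_push_prefix:
  assumes "reduced (u @ s)" "reduced t" "length t \<le> length s"
  shows "\<exists>t'. foldr push (u @ s) t = u @ t'"
proof -
  obtain w1 c t1 where *: "u @ s = w1 @ c" "t = inv_word c @ t1" "foldr push (u @ s) t = w1 @ t1"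
    using foldr_push_cancel[OF assms(1,2)] by blast
  have "length c \<le> length s"
    using *(2) assms(3) by (simp add: inv_word_def)
  moreover have "length u + length s = length w1 + length c"
    using arg_cong[OF *(1), of length] by simp
  ultimately have "length u \<le> length w1" by linarith
  with *(1) obtain w2 where "w1 = u @ w2"
    by (metis append_eq_append_conv_if append_take_drop_id take_all)
  with *(3) show ?thesis by simp
qed

section \<open>Reading words in a graph\<close>

lemma read_word_append:
  "read_word E x (u @ v) y \<longleftrightarrow> (\<exists>z. read_word E x u z \<and> read_word E z v y)"
  by (induction u arbitrary: x) auto

lemma read_letter_inv: "read_letter E x (inv_letter l) y \<longleftrightarrow> read_letter E y l x"
  by (cases l) auto

lemma read_inv_word: "read_word E x (inv_word w) y \<longleftrightarrow> read_word E y w x"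
  by (induction w arbitrary: y)
    (auto simp: inv_word_def read_word_append read_letter_inv)

lemma read_letter_det:
  "A_graph A V E \<Longrightarrow> read_letter E x l y \<Longrightarrow> read_letter E x l y' \<Longrightarrow> y = y'"
  by (cases l) (auto simp: A_graph_def split: if_splits)

lemma read_word_det:
  "A_graph A V E \<Longrightarrow> read_word E x w y \<Longrightarrow> read_word E x w y' \<Longrightarrow> y = y'"
proof (induction w arbitrary: x)
  case (Cons l w)
  then show ?case using read_letter_det[OF Cons.prems(1)] by (metis read_word.simps(2))
qed simp

lemma read_letter_closed:
  "A_graph A V E \<Longrightarrow> read_letter E x l y \<Longrightarrow> x \<in> V \<and> y \<in> V \<and> fst l \<in> A"
  by (cases l) (auto simp: A_graph_def split: if_splits)

lemma read_word_closed:
  assumes "A_graph A V E" "read_word E x w y"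
  shows "fst ` set w \<subseteq> A" and "x \<in> V \<Longrightarrow> y \<in> V"
  using assms(2) by (induction w arbitrary: x) (auto dest: read_letter_closed[OF assms(1)])

text \<open>Cancelling a letter amounts to going back along the edge just read; each letter being injective on
the vertices, this leads back to the starting point.\<close>

lemma read_push:
  assumes "A_graph A V E" "read_letter E x l z" "read_word E z w y"
  shows "read_word E x (push l w) y"
proof (cases "w \<noteq> [] \<and> hd w = inv_letter l")
  case True
  then obtain w' where w: "w = inv_letter l # w'" by (cases w) auto
  with assms(3) obtain z' where z': "read_letter E z (inv_letter l) z'" "read_word E z' w' y"
    by auto
  have "z' = x"
    using read_letter_det[OF assms(1) z'(1)] assms(2) by (simp add: read_letter_inv)
  with z' w show ?thesis by simp
next
  case False
  then have "push l w = l # w" by (cases w) auto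
  with assms show ?thesis by auto
qed

lemma read_foldr_push:
  assumes "A_graph A V E"
  shows "read_word E x u y \<Longrightarrow> read_word E y v z \<Longrightarrow> read_word E x (foldr push u v) z"
  by (induction u arbitrary: x) (auto intro: read_push[OF assms])

lemma read_free_reduce:
  "A_graph A V E \<Longrightarrow> read_word E x u y \<Longrightarrow> read_word E x (free_reduce u) y"
  using read_foldr_push[of A V E x u y "[]" y] by simp

lemma connected_read:
  assumes "A_graph A V E" "connected_graph V E" "x \<in> V" "y \<in> V"
  shows "\<exists>w. reduced w \<and> read_word E x w y"
proof -
  have "(x, y) \<in> {(x, y). \<exists>a. (x, a, y) \<in> E \<or> (y, a, x) \<in> E}\<^sup>*"
    using assms by (auto simp: connected_graph_def)
  then have "\<exists>w. read_word E x w y"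
  proof (induction rule: rtrancl_induct)
    case base
    show ?case by (rule exI[of _ "[]"]) simp
  next
    case (step y z)
    then obtain w a where w: "read_word E x w y" and "(y, a, z) \<in> E \<or> (z, a, y) \<in> E" by auto
    then obtain l where "read_letter E y l z"
      by (metis read_letter.simps)
    with w have "read_word E x (w @ [l]) z" by (auto simp: read_word_append)
    then show ?case by blast
  qed
  then obtain w where "read_word E x w y" by blast
  then have "read_word E x (free_reduce w) y" by (rule read_free_reduce[OF assms(1)])
  then show ?thesis using reduced_foldr_push[of "[]" w] by auto
qed

section \<open>The subgroup of loops at a vertex\<close>

text \<open>For an admissible pair this is the subgroup that has the pair as its Stallings graph.\<close>

definition loops :: "('v, 'a) edges \<Rightarrow> 'v \<Rightarrow> 'a word set" where
  "loops E p = {u. reduced u \<and> read_word E p u p}"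

lemma admissible_A_graph: "admissible A V E p \<Longrightarrow> A_graph A V E"
  by (simp add: admissible_def)

lemma carrier_free_group: "u \<in> carrier (free_group A) \<longleftrightarrow> reduced u \<and> fst ` set u \<subseteq> A"
  by (simp add: free_group_def)

lemma loops_carrier: "A_graph A V E \<Longrightarrow> loops E p \<subseteq> carrier (free_group A)"
  using read_word_closed(1) by (fastforce simp: loops_def carrier_free_group)

lemma mult_free_group: "u \<otimes>\<^bsub>free_group A\<^esub> v = foldr push u v"
  by (simp add: free_group_def)

lemma one_free_group: "\<one>\<^bsub>free_group A\<^esub> = []"
  by (simp add: free_group_def)

lemma free_reduce_mult:
  "free_reduce u \<otimes>\<^bsub>free_group A\<^esub> free_reduce v = free_reduce (u @ v)"
  by (simp add: mult_free_group foldr_push_free_reduce reduced_foldr_push)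

lemma free_reduce_carrier:
  "fst ` set u \<subseteq> A \<Longrightarrow> free_reduce u \<in> carrier (free_group A)"
  using letters_foldr_push[of u "[]"] by (fastforce simp: carrier_free_group reduced_foldr_push)

lemma inv_free_group:
  assumes "u \<in> carrier (free_group A)"
  shows "inv\<^bsub>free_group A\<^esub> u = free_reduce (inv_word u)"
proof (rule group.inv_equality[OF group_free_group _ assms])
  show "free_reduce (inv_word u) \<in> carrier (free_group A)"
    using assms by (intro free_reduce_carrier) (simp add: carrier_free_group)
  have "foldr push (free_reduce (inv_word u)) u = foldr push (inv_word u) (foldr push u [])"
    using assms by (simp add: carrier_free_group foldr_push_free_reduce foldr_push_Nil)
  then show "free_reduce (inv_word u) \<otimes>\<^bsub>free_group A\<^esub> u = \<one>\<^bsub>free_group A\<^esub>"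
    by (simp add: mult_free_group one_free_group foldr_push_inv_word_left)
qed

lemma subgroup_loops:
  assumes E: "A_graph A V E"
  shows "subgroup (loops E p) (free_group A)"
proof (rule group.subgroupI[OF group_free_group])
  show "loops E p \<subseteq> carrier (free_group A)" by (rule loops_carrier[OF E])
  have "[] \<in> loops E p" by (simp add: loops_def)
  then show "loops E p \<noteq> {}" by blast
next
  fix u assume u: "u \<in> loops E p"
  then have "u \<in> carrier (free_group A)" using loops_carrier[OF E] by blast
  then have "inv\<^bsub>free_group A\<^esub> u = free_reduce (inv_word u)" by (rule inv_free_group)
  moreover have "read_word E p (free_reduce (inv_word u)) p"
    using u by (intro read_free_reduce[OF E]) (simp add: read_inv_word loops_def)
  ultimately show "inv\<^bsub>free_group A\<^esub> u \<in> loops E p"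
    by (simp add: loops_def reduced_foldr_push)
next
  fix u v assume "u \<in> loops E p" "v \<in> loops E p"
  then show "u \<otimes>\<^bsub>free_group A\<^esub> v \<in> loops E p"
    using read_foldr_push[OF E, of p u p v p]
    by (simp add: loops_def mult_free_group reduced_foldr_push)
qed

text \<open>With a path \<open>t x\<close> chosen from the base vertex to every vertex \<open>x\<close>, a loop is the product of the
elements \<open>t x \<cdot> l \<cdot> (t z)\<inverse>\<close> over its steps from \<open>x\<close> to \<open>z\<close> with letter \<open>l\<close>: consecutive factors cancel
in between. There are only finitely many such elements.\<close>

lemma finitely_generated_loops:
  assumes adm: "admissible A V E p" and A: "finite A"
  shows "finitely_generated_subgroup (loops E p) A"
proof -
  interpret F: group "free_group A" by (rule group_free_group)
  have E: "A_graph A V E" and V: "finite V" "p \<in> V" and C: "connected_graph V E"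
    using adm by (auto simp: admissible_def)
  have "\<exists>w. read_word E p w x \<and> (x = p \<longrightarrow> w = [])" if "x \<in> V" for x
    using connected_read[OF E C V(2) that] by (cases "x = p") auto
  then obtain t where t: "\<And>x. x \<in> V \<Longrightarrow> read_word E p (t x) x" and tp: "t p = []"
    using V(2) by metis
  \<comment> \<open>The empty path at \<open>p\<close> makes the product along a loop equal to the loop itself.\<close>
  define gen where "gen = (\<lambda>(x, l, z). free_reduce (t x @ [l] @ inv_word (t z)))"
  define S where "S = gen ` {(x, l, z). x \<in> V \<and> read_letter E x l z}"
  have "{(x, l, z). x \<in> V \<and> read_letter E x l z} \<subseteq> V \<times> (A \<times> UNIV) \<times> V"
    using read_letter_closed[OF E] by fastforce
  then have finS: "finite S"
    unfolding S_def using V A by (meson finite_SigmaI finite_imageI finite_subset finite)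
  have SH: "S \<subseteq> loops E p"
  proof
    fix s assume "s \<in> S"
    then obtain x l z where s: "s = free_reduce (t x @ [l] @ inv_word (t z))"
      and x: "x \<in> V" "read_letter E x l z" by (auto simp: S_def gen_def)
    have "z \<in> V" using read_letter_closed[OF E x(2)] by blast
    have "read_word E p (t x @ [l] @ inv_word (t z)) p"
      using x t[OF x(1)] t[OF \<open>z \<in> V\<close>] by (auto simp: read_word_append read_inv_word)
    then have "read_word E p s p"
      unfolding s by (rule read_free_reduce[OF E])
    moreover have "reduced s"
      unfolding s by (rule reduced_foldr_push) simp
    ultimately show "s \<in> loops E p"
      by (simp add: loops_def)
  qed
  have red: "free_reduce (t x @ w @ inv_word (t y)) \<in> generate (free_group A) S"
    if "x \<in> V" "read_word E x w y" for x w y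
    using that
  proof (induction w arbitrary: x)
    case Nil
    then have "free_reduce (t x @ [] @ inv_word (t y)) = []"
      by (simp add: foldr_push_inv_word_right)
    then show ?case using generate.one[of "free_group A" S] by (simp add: one_free_group)
  next
    case (Cons l w)
    then obtain z where z: "read_letter E x l z" "read_word E z w y" by auto
    have "z \<in> V" using read_letter_closed[OF E z(1)] by blast
    have "free_reduce (t x @ [l] @ inv_word (t z)) \<in> S"
      unfolding S_def by (rule image_eqI[of _ _ "(x, l, z)"]) (auto simp: gen_def z Cons.prems)
    then have "free_reduce (t x @ [l] @ inv_word (t z)) \<otimes>\<^bsub>free_group A\<^esub>
        free_reduce (t z @ w @ inv_word (t y)) \<in> generate (free_group A) S"
      using Cons.IH[OF \<open>z \<in> V\<close> z(2)] by (blast intro: generate.eng generate.incl)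
    also have "free_reduce (t x @ [l] @ inv_word (t z)) \<otimes>\<^bsub>free_group A\<^esub>
        free_reduce (t z @ w @ inv_word (t y)) = free_reduce (t x @ (l # w) @ inv_word (t y))"
      by (simp only: free_reduce_mult) (simp add: foldr_push_inv_word_left reduced_foldr_push)
    finally show ?case .
  qed
  have "loops E p \<subseteq> generate (free_group A) S"
  proof
    fix u assume u: "u \<in> loops E p"
    then have "free_reduce (t p @ u @ inv_word (t p)) = u"
      by (simp add: loops_def tp inv_word_def foldr_push_Nil)
    with red[OF V(2), of u p] u show "u \<in> generate (free_group A) S"
      by (simp add: loops_def)
  qed
  moreover have "generate (free_group A) S \<subseteq> loops E p"
    using F.generate_subgroup_incl[OF SH subgroup_loops[OF E]] .
  ultimately show ?thesis
    unfolding finitely_generated_subgroup_def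
    using subgroup_loops[OF E, of p] finS SH loops_carrier[OF E, of p] by blast
qed

section \<open>Uniqueness of the Stallings graph\<close>

lemma card_le_Suc0_if_eq: "(\<And>x y. x \<in> X \<Longrightarrow> y \<in> X \<Longrightarrow> x = y) \<Longrightarrow> card X \<le> Suc 0"
  by (metis card.infinite card_le_Suc0_iff_eq zero_le)

text \<open>A vertex that is not a leaf has a way out other than the edge by which it was entered.\<close>

lemma non_leaf_step:
  assumes adm: "admissible A V E p" and u: "reduced u" "read_word E p u q" and "q \<noteq> p"
  shows "\<exists>l z. reduced (u @ [l]) \<and> read_letter E q l z"
proof (rule ccontr)
  assume neg: "\<not> ?thesis"
  have E: "A_graph A V E" and "p \<in> V" using adm by (auto simp: admissible_def)
  have "q \<in> V" using read_word_closed(2)[OF E u(2) \<open>p \<in> V\<close>] .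
  with adm \<open>q \<noteq> p\<close> have nl: "\<not> leaf E q" by (auto simp: admissible_def)
  have "u \<noteq> []" using u(2) \<open>q \<noteq> p\<close> by auto
  \<comment> \<open>The one letter that would cancel against the end of \<open>u\<close>.\<close>
  define l0 where "l0 = inv_letter (last u)"
  have only: "l = l0" if "read_letter E q l z" for l z
  proof -
    have "\<not> reduced (u @ [l])" using neg that by blast
    with u(1) show ?thesis by (auto simp: reduced_append l0_def)
  qed
  obtain a b where l0: "l0 = (a, b)" by (cases l0)
  have out: "(q, a', z) \<in> E \<Longrightarrow> a' = a \<and> b" for a' z
    using only[of "(a', True)" z] l0 by auto
  have inc: "(z, a', q) \<in> E \<Longrightarrow> a' = a \<and> \<not> b" for a' z
    using only[of "(a', False)" z] l0 by auto
  have fn: "(q, a, z) \<in> E \<Longrightarrow> (q, a, z') \<in> E \<Longrightarrow> z = z'"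
    "(z, a, q) \<in> E \<Longrightarrow> (z', a, q) \<in> E \<Longrightarrow> z = z'" for z z'
    using E unfolding A_graph_def by blast+
  have "card {(x, a, y) \<in> E. x = q} + card {(x, a, y) \<in> E. y = q} \<le> 1"
  proof (cases b)
    case True
    then have "{(x, a, y) \<in> E. y = q} = {}" using inc by auto
    then have "card {(x, a, y) \<in> E. y = q} = 0" by (simp only: card.empty)
    moreover have "card {(x, a, y) \<in> E. x = q} \<le> Suc 0"
    proof (rule card_le_Suc0_if_eq)
      fix e1 e2 assume "e1 \<in> {(x, a, y) \<in> E. x = q}" "e2 \<in> {(x, a, y) \<in> E. x = q}"
      then obtain a1 z1 a2 z2 where e: "e1 = (q, a1, z1)" "(q, a1, z1) \<in> E"
        "e2 = (q, a2, z2)" "(q, a2, z2) \<in> E" by auto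
      moreover have "a1 = a" "a2 = a" using out e by blast+
      ultimately show "e1 = e2" using fn(1)[of z1 z2] by simp
    qed
    ultimately show ?thesis by linarith
  next
    case False
    then have "{(x, a, y) \<in> E. x = q} = {}" using out by auto
    then have "card {(x, a, y) \<in> E. x = q} = 0" by (simp only: card.empty)
    moreover have "card {(x, a, y) \<in> E. y = q} \<le> Suc 0"
    proof (rule card_le_Suc0_if_eq)
      fix e1 e2 assume "e1 \<in> {(x, a, y) \<in> E. y = q}" "e2 \<in> {(x, a, y) \<in> E. y = q}"
      then obtain a1 z1 a2 z2 where e: "e1 = (z1, a1, q)" "(z1, a1, q) \<in> E"
        "e2 = (z2, a2, q)" "(z2, a2, q) \<in> E" by auto
      moreover have "a1 = a" "a2 = a" using inc e by blast+
      ultimately show "e1 = e2" using fn(2)[of z1 z2] by simp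
    qed
    ultimately show ?thesis by linarith
  qed
  with nl show False by (simp add: leaf_def)
qed

lemma extend_or_loop:
  assumes adm: "admissible A V E p" and u: "reduced u" "read_word E p u q"
  shows "(\<exists>s. u @ s \<in> loops E p) \<or>
    (\<exists>s q'. length s = N \<and> reduced (u @ s) \<and> read_word E p (u @ s) q')"
proof (induction N)
  case 0
  then show ?case using u by auto
next
  case (Suc N)
  show ?case
  proof (cases "\<exists>s. u @ s \<in> loops E p")
    case False
    with Suc obtain s q' where s: "length s = N" "reduced (u @ s)" "read_word E p (u @ s) q'" by blast
    with False have "q' \<noteq> p" by (auto simp: loops_def)
    from non_leaf_step[OF adm s(2,3) this] obtain l z
      where "reduced ((u @ s) @ [l])" "read_letter E q' l z" by blast
    with s have "length (s @ [l]) = Suc N \<and> reduced (u @ s @ [l]) \<and> read_word E p (u @ s @ [l]) z"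
      by (auto simp: read_word_append)
    then show ?thesis by blast
  next
    case True
    then show ?thesis by blast
  qed
qed

text \<open>This is where the absence of leaves enters the uniqueness proof: it makes the words that can be read
from the base vertex the prefixes of the words in the subgroup, hence determined by the subgroup. Walk on
from the end of \<open>u\<close> without backtracking. If the walk never meets the base vertex, it becomes as long as any of
a finite choice of ways back; closing it up by the one chosen and reducing leaves the prefix \<open>u\<close> intact.\<close>

lemma extend_to_loop:
  assumes adm: "admissible A V E p" and u: "reduced u" "read_word E p u q"
  shows "\<exists>s. u @ s \<in> loops E p"
proof -
  have E: "A_graph A V E" and V: "finite V" "p \<in> V" and C: "connected_graph V E"
    using adm by (auto simp: admissible_def)
  have "\<forall>x\<in>V. \<exists>w. reduced w \<and> read_word E x w p"
    using connected_read[OF E C _ V(2)] by blast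
  then obtain t where t: "\<And>x. x \<in> V \<Longrightarrow> reduced (t x) \<and> read_word E x (t x) p"
    by metis
  define N where "N = Max (length ` t ` V)"
  have N: "length (t x) \<le> N" if "x \<in> V" for x
    unfolding N_def using that V by (intro Max_ge) auto
  from extend_or_loop[OF adm u, of N] show ?thesis
  proof
    assume "\<exists>s q'. length s = N \<and> reduced (u @ s) \<and> read_word E p (u @ s) q'"
    then obtain s q' where s: "length s = N" "reduced (u @ s)" "read_word E p (u @ s) q'" by blast
    have "q' \<in> V" using read_word_closed(2)[OF E s(3) V(2)] .
    then have "reduced (t q')" "length (t q') \<le> length s" using s(1) N t by auto
    from foldr_push_prefix[OF s(2) this]
    obtain t' where "foldr push (u @ s) (t q') = u @ t'" by blast
    moreover have "reduced (foldr push (u @ s) (t q'))"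
      using t[OF \<open>q' \<in> V\<close>] by (intro reduced_foldr_push) simp
    moreover have "read_word E p (foldr push (u @ s) (t q')) p"
      using t[OF \<open>q' \<in> V\<close>] by (intro read_foldr_push[OF E s(3)]) simp
    ultimately have "u @ t' \<in> loops E p" unfolding loops_def by simp
    then show ?thesis by blast
  qed blast
qed

text \<open>The isomorphism between two graphs of the same subgroup: it matches the vertices reached by the same
word.\<close>

definition corresponds ::
  "('v, 'a) edges \<Rightarrow> 'v \<Rightarrow> ('w, 'a) edges \<Rightarrow> 'w \<Rightarrow> 'v \<Rightarrow> 'w \<Rightarrow> bool" where
  "corresponds E p E' p' q q' \<longleftrightarrow> (\<exists>u. reduced u \<and> read_word E p u q \<and> read_word E' p' u q')"

lemma corresponds_sym: "corresponds E p E' p' q q' \<longleftrightarrow> corresponds E' p' E p q' q"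
  by (auto simp: corresponds_def)

lemma corresponds_ex:
  assumes "admissible A V E p" "admissible A' V' E' p'" "loops E p = loops E' p'" "q \<in> V"
  shows "\<exists>q'\<in>V'. corresponds E p E' p' q q'"
proof -
  have "A_graph A V E" "connected_graph V E" "p \<in> V" using assms by (auto simp: admissible_def)
  from connected_read[OF this assms(4)] obtain u where u: "reduced u" "read_word E p u q" by blast
  from extend_to_loop[OF assms(1) this] obtain s where "u @ s \<in> loops E' p'"
    using assms(3) by auto
  then obtain q' where q': "read_word E' p' u q'"
    by (auto simp: loops_def read_word_append)
  moreover have "q' \<in> V'"
    using assms(2) q' read_word_closed(2)[of A' V' E' p' u q'] by (auto simp: admissible_def)
  ultimately show ?thesis using u by (auto simp: corresponds_def)
qed

text \<open>If \<open>u\<close> and \<open>v\<close> lead to the same vertex of the first graph, then \<open>u v\<inverse>\<close> is in the common subgroup and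
so is a loop in the second graph, where \<open>u = (u v\<inverse>) v\<close> must lead to the same vertex as \<open>v\<close>.\<close>

lemma corresponds_unique:
  assumes E: "A_graph A V E" and E': "A_graph A' V' E'" and eq: "loops E p = loops E' p'"
    and "corresponds E p E' p' q q1" "corresponds E p E' p' q q2"
  shows "q1 = q2"
proof -
  obtain u v where u: "reduced u" "read_word E p u q" "read_word E' p' u q1"
    and v: "reduced v" "read_word E p v q" "read_word E' p' v q2"
    using assms(4,5) by (auto simp: corresponds_def)
  define w where "w = foldr push u (free_reduce (inv_word v))"
  have "read_word E p w p"
    unfolding w_def using u(2) v(2)
    by (intro read_foldr_push[OF E] read_free_reduce[OF E]) (auto simp: read_inv_word)
  then have "w \<in> loops E' p'"
    unfolding eq[symmetric] by (simp add: loops_def w_def reduced_foldr_push)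
  then have "read_word E' p' (foldr push w v) q2"
    using v(3) by (intro read_foldr_push[OF E']) (auto simp: loops_def)
  also have "foldr push w v = u"
    unfolding w_def using u(1) v(1)
    by (metis foldr_push_Nil foldr_push_assoc foldr_push_inv_word_left reduced.simps(1))
  finally show ?thesis using read_word_det[OF E' _ u(3)] by blast
qed

text \<open>If \<open>u\<close> leads to \<open>x\<close>, then the reduced form \<open>v\<close> of \<open>u a\<close> leads to \<open>y\<close>. In the second graph \<open>v\<close> can be
read as well, and \<open>u\<inverse> v\<close>, which reduces to \<open>a\<close>, goes from \<open>x'\<close> to \<open>y'\<close>.\<close>

lemma corresponds_edge:
  assumes adm: "admissible A V E p" and adm': "admissible A' V' E' p'"
    and eq: "loops E p = loops E' p'" and e: "(x, a, y) \<in> E"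
    and x: "corresponds E p E' p' x x'" and y: "corresponds E p E' p' y y'"
  shows "(x', a, y') \<in> E'"
proof -
  have E: "A_graph A V E" and E': "A_graph A' V' E'" using adm adm' by (auto simp: admissible_def)
  obtain u where u: "reduced u" "read_word E p u x" "read_word E' p' u x'"
    using x by (auto simp: corresponds_def)
  define v where "v = foldr push u [(a, True)]"
  have v: "reduced v" "read_word E p v y"
    unfolding v_def using u(2) e by (auto simp: reduced_foldr_push intro!: read_foldr_push[OF E])
  then obtain s where "v @ s \<in> loops E' p'"
    using extend_to_loop[OF adm v] eq by auto
  then obtain y1 where y1: "read_word E' p' v y1" by (auto simp: loops_def read_word_append)
  with v have "corresponds E p E' p' y y1" by (auto simp: corresponds_def)
  with y have "y1 = y'" using corresponds_unique[OF E E' eq] by blast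
  have "read_word E' x' (foldr push (inv_word u) v) y1"
    using u(3) y1 by (intro read_foldr_push[OF E']) (auto simp: read_inv_word)
  moreover have "foldr push (inv_word u) v = [(a, True)]"
    unfolding v_def by (simp add: foldr_push_inv_word_left)
  ultimately show ?thesis using \<open>y1 = y'\<close> by simp
qed

definition rename :: "('v \<Rightarrow> 'w) \<Rightarrow> ('v, 'a) edges \<Rightarrow> ('w, 'a) edges" where
  "rename \<sigma> E = (\<lambda>(x, a, y). (\<sigma> x, a, \<sigma> y)) ` E"

lemma stallings_graph_unique:
  assumes adm: "admissible A V E p" and adm': "admissible A V' E' p'"
    and eq: "loops E p = loops E' p'"
  shows "\<exists>\<sigma>. bij_betw \<sigma> V V' \<and> \<sigma> p = p' \<and> rename \<sigma> E = E'"
proof -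
  let ?K = "corresponds E p E' p'"
  have E: "A_graph A V E" and E': "A_graph A V' E'" using adm adm' by (auto simp: admissible_def)
  obtain \<sigma> where \<sigma>: "\<And>q. q \<in> V \<Longrightarrow> \<sigma> q \<in> V' \<and> ?K q (\<sigma> q)"
    using corresponds_ex[OF adm adm' eq] by metis
  have uniq: "?K q q1 \<Longrightarrow> ?K q q2 \<Longrightarrow> q1 = q2" for q q1 q2
    using corresponds_unique[OF E E' eq] by blast
  have uniq': "?K q1 q \<Longrightarrow> ?K q2 q \<Longrightarrow> q1 = q2" for q q1 q2
    using corresponds_unique[OF E' E eq[symmetric]] corresponds_sym by metis
  have ex': "\<exists>q\<in>V. ?K q q'" if "q' \<in> V'" for q'
    using corresponds_ex[OF adm' adm eq[symmetric] that] corresponds_sym by metis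
  have "inj_on \<sigma> V" using \<sigma> uniq' by (metis inj_onI)
  moreover have "\<sigma> ` V = V'" using \<sigma> ex' uniq by (auto simp: image_iff) metis
  ultimately have "bij_betw \<sigma> V V'" by (simp add: bij_betw_def)
  moreover have "\<sigma> p = p'"
  proof -
    have "p \<in> V" using adm by (simp add: admissible_def)
    moreover have "?K p p'" by (auto simp: corresponds_def intro!: exI[of _ "[]"])
    ultimately show ?thesis using uniq \<sigma> by blast
  qed
  moreover have "rename \<sigma> E = E'"
  proof
    show "rename \<sigma> E \<subseteq> E'"
    proof
      fix e assume "e \<in> rename \<sigma> E"
      then obtain x a y where e: "e = (\<sigma> x, a, \<sigma> y)" "(x, a, y) \<in> E" by (auto simp: rename_def)
      then have "x \<in> V" "y \<in> V" using E by (auto simp: A_graph_def)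
      then show "e \<in> E'" using corresponds_edge[OF adm adm' eq e(2)] \<sigma> e(1) by blast
    qed
    show "E' \<subseteq> rename \<sigma> E"
    proof
      fix e assume e: "e \<in> E'"
      obtain x' a y' where [simp]: "e = (x', a, y')" by (cases e)
      have "x' \<in> V'" "y' \<in> V'" using E' e by (auto simp: A_graph_def)
      then obtain x y where x: "x \<in> V" "?K x x'" and y: "y \<in> V" "?K y y'" using ex' by metis
      have "(x, a, y) \<in> E"
        using corresponds_edge[OF adm' adm eq[symmetric], of x' a y' x y] x y e corresponds_sym
        by (metis \<open>e = (x', a, y')\<close>)
      moreover have "x' = \<sigma> x" "y' = \<sigma> y" using \<sigma> x y uniq by blast+
      ultimately show "e \<in> rename \<sigma> E" by (force simp: rename_def)
    qed
  qed
  ultimately show ?thesis by blast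
qed

section \<open>Renaming vertices\<close>

lemma mem_rename:
  "(u', a, v') \<in> rename \<sigma> E \<longleftrightarrow> (\<exists>u v. u' = \<sigma> u \<and> v' = \<sigma> v \<and> (u, a, v) \<in> E)"
  unfolding rename_def by force

lemma inj_on_rename:
  assumes "A_graph A V E" "inj_on \<sigma> V"
  shows "inj_on (\<lambda>(x, a, y). (\<sigma> x, a, \<sigma> y)) E"
proof (rule inj_onI)
  fix e e' assume e: "e \<in> E" "e' \<in> E"
    and eq: "(\<lambda>(x, a, y). (\<sigma> x, a, \<sigma> y)) e = (\<lambda>(x, a, y). (\<sigma> x, a, \<sigma> y)) e'"
  obtain x a y where x: "e = (x, a, y)" by (cases e)
  obtain x' a' y' where x': "e' = (x', a', y')" by (cases e')
  have "x \<in> V" "y \<in> V" "x' \<in> V" "y' \<in> V" using e x x' assms(1) by (auto simp: A_graph_def)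
  with eq show "e = e'" using assms(2) by (auto simp: x x' dest: inj_onD)
qed

lemma rename_iff:
  assumes E: "A_graph A V E" and \<sigma>: "inj_on \<sigma> V" and V: "x \<in> V" "y \<in> V"
  shows "(\<sigma> x, a, \<sigma> y) \<in> rename \<sigma> E \<longleftrightarrow> (x, a, y) \<in> E"
proof
  assume "(\<sigma> x, a, \<sigma> y) \<in> rename \<sigma> E"
  then obtain x' y' where e: "(x', a, y') \<in> E" "\<sigma> x' = \<sigma> x" "\<sigma> y' = \<sigma> y"
    by (auto simp: rename_def)
  then have "x' \<in> V" "y' \<in> V" using E by (auto simp: A_graph_def)
  with e V \<sigma> show "(x, a, y) \<in> E" by (metis inj_onD)
qed (force simp: rename_def)

lemma A_graph_rename:
  assumes E: "A_graph A V E" and \<sigma>: "bij_betw \<sigma> V V'"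
  shows "A_graph A V' (rename \<sigma> E)"
proof -
  have i: "inj_on \<sigma> V" and im: "\<sigma> ` V = V'" using \<sigma> by (auto simp: bij_betw_def)
  have EV: "E \<subseteq> V \<times> A \<times> V" using E by (simp add: A_graph_def)
  have "rename \<sigma> E \<subseteq> V' \<times> A \<times> V'" using EV im by (auto simp: rename_def)
  moreover have "v = v'" if vv: "(u, a, v) \<in> rename \<sigma> E" "(u, a, v') \<in> rename \<sigma> E" for u a v v'
  proof -
    obtain x y y' x' where e: "u = \<sigma> x" "v = \<sigma> y" "(x, a, y) \<in> E"
        "u = \<sigma> x'" "v' = \<sigma> y'" "(x', a, y') \<in> E"
      using vv unfolding mem_rename by blast
    then have "x = x'" using EV i by (metis SigmaD1 inj_onD subsetD)
    with e E have "y = y'" by (auto simp: A_graph_def)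
    with e show ?thesis by simp
  qed
  moreover have "u = u'" if vv: "(u, a, v) \<in> rename \<sigma> E" "(u', a, v) \<in> rename \<sigma> E" for u u' a v
  proof -
    obtain x y y' x' where e: "u = \<sigma> x" "v = \<sigma> y" "(x, a, y) \<in> E"
        "u' = \<sigma> x'" "v = \<sigma> y'" "(x', a, y') \<in> E"
      using vv unfolding mem_rename by blast
    then have "y = y'" using EV i by (metis SigmaD2 inj_onD subsetD)
    with e E have "x = x'" by (auto simp: A_graph_def)
    with e show ?thesis by simp
  qed
  ultimately show ?thesis by (simp add: A_graph_def)
qed

lemma admissible_rename:
  assumes adm: "admissible A V E p" and \<sigma>: "bij_betw \<sigma> V V'"
  shows "admissible A V' (rename \<sigma> E) (\<sigma> p)"
proof -
  have E: "A_graph A V E" and V: "finite V" "p \<in> V" and C: "connected_graph V E"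
    using adm by (auto simp: admissible_def)
  have i: "inj_on \<sigma> V" and im: "\<sigma> ` V = V'" using \<sigma> by (auto simp: bij_betw_def)
  have EV: "E \<subseteq> V \<times> A \<times> V" using E by (simp add: A_graph_def)
  note ie = inj_on_rename[OF E i]
  have "connected_graph V' (rename \<sigma> E)"
    unfolding connected_graph_def
  proof (intro ballI)
    fix u' v' assume "u' \<in> V'" "v' \<in> V'"
    then obtain u v where u: "u \<in> V" "u' = \<sigma> u" and v: "v \<in> V" "v' = \<sigma> v" using im by auto
    have "(u, v) \<in> {(x, y). \<exists>a. (x, a, y) \<in> E \<or> (y, a, x) \<in> E}\<^sup>*"
      using C u v by (auto simp: connected_graph_def)
    then have "(\<sigma> u, \<sigma> v) \<in>
        {(x, y). \<exists>a. (x, a, y) \<in> rename \<sigma> E \<or> (y, a, x) \<in> rename \<sigma> E}\<^sup>*"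
      (is "_ \<in> ?r'\<^sup>*")
    proof (induction rule: rtrancl_induct)
      case (step y z)
      then have "(\<sigma> y, \<sigma> z) \<in> ?r'" unfolding rename_def by force
      with step.IH show ?case by (rule rtrancl_into_rtrancl)
    qed simp
    then show "(u', v') \<in>
        {(x, y). \<exists>a. (x, a, y) \<in> rename \<sigma> E \<or> (y, a, x) \<in> rename \<sigma> E}\<^sup>*"
      using u v by simp
  qed
  moreover have "\<not> leaf (rename \<sigma> E) (\<sigma> v)" if v: "v \<in> V" "v \<noteq> p" for v
  proof -
    have inV: "x \<in> V" "y \<in> V" if "(x, a, y) \<in> E" for x a y using EV that by auto
    have 1: "{(x, a, y) \<in> rename \<sigma> E. x = \<sigma> v} = rename \<sigma> {(x, a, y) \<in> E. x = v}"
      using inV v(1) by (auto simp: mem_rename inj_on_eq_iff[OF i]) blast+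
    have 2: "{(x, a, y) \<in> rename \<sigma> E. y = \<sigma> v} = rename \<sigma> {(x, a, y) \<in> E. y = v}"
      using inV v(1) by (auto simp: mem_rename inj_on_eq_iff[OF i]) blast+
    have "card {(x, a, y) \<in> rename \<sigma> E. x = \<sigma> v} = card {(x, a, y) \<in> E. x = v}"
      unfolding 1 unfolding rename_def by (rule card_image[OF inj_on_subset[OF ie]]) auto
    moreover have "card {(x, a, y) \<in> rename \<sigma> E. y = \<sigma> v} = card {(x, a, y) \<in> E. y = v}"
      unfolding 2 unfolding rename_def by (rule card_image[OF inj_on_subset[OF ie]]) auto
    moreover have "\<not> leaf E v" using adm v by (simp add: admissible_def)
    ultimately show ?thesis by (simp add: leaf_def)
  qed
  moreover have "finite V'" "\<sigma> p \<in> V'" using V im by auto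
  ultimately show ?thesis
    using A_graph_rename[OF E \<sigma>] im V(2) unfolding admissible_def by blast
qed

lemma read_letter_rename:
  assumes E: "A_graph A V E" and \<sigma>: "inj_on \<sigma> V" and x: "x \<in> V"
  shows "read_letter (rename \<sigma> E) (\<sigma> x) l y' \<longleftrightarrow> (\<exists>y. y' = \<sigma> y \<and> read_letter E x l y)"
proof -
  obtain a b where l: "l = (a, b)" by (cases l)
  have EV: "E \<subseteq> V \<times> A \<times> V" using E by (simp add: A_graph_def)
  show ?thesis
  proof
    assume r: "read_letter (rename \<sigma> E) (\<sigma> x) l y'"
    then obtain y where y: "y \<in> V" "y' = \<sigma> y"
      using EV by (cases b) (auto simp: l rename_def)
    then have "read_letter E x l y"
      using r rename_iff[OF E \<sigma> x y(1)] rename_iff[OF E \<sigma> y(1) x] by (cases b) (auto simp: l)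
    with y show "\<exists>y. y' = \<sigma> y \<and> read_letter E x l y" by blast
  next
    assume "\<exists>y. y' = \<sigma> y \<and> read_letter E x l y"
    then show "read_letter (rename \<sigma> E) (\<sigma> x) l y'"
      by (cases b) (force simp: l rename_def)+
  qed
qed

lemma read_word_rename:
  assumes E: "A_graph A V E" and \<sigma>: "inj_on \<sigma> V"
  shows "x \<in> V \<Longrightarrow>
    read_word (rename \<sigma> E) (\<sigma> x) w y' \<longleftrightarrow> (\<exists>y\<in>V. y' = \<sigma> y \<and> read_word E x w y)"
proof (induction w arbitrary: x)
  case Nil
  then show ?case by auto
next
  case (Cons l w)
  have "read_word (rename \<sigma> E) (\<sigma> x) (l # w) y' \<longleftrightarrow>
      (\<exists>z. read_letter E x l z \<and> read_word (rename \<sigma> E) (\<sigma> z) w y')"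
    using read_letter_rename[OF E \<sigma> Cons.prems] by auto
  also have "\<dots> \<longleftrightarrow> (\<exists>z. read_letter E x l z \<and> (\<exists>y\<in>V. y' = \<sigma> y \<and> read_word E z w y))"
    using Cons.IH read_letter_closed[OF E] by blast
  finally show ?case by auto
qed

lemma loops_rename:
  assumes E: "A_graph A V E" and \<sigma>: "inj_on \<sigma> V" and p: "p \<in> V"
  shows "loops (rename \<sigma> E) (\<sigma> p) = loops E p"
  unfolding loops_def using read_word_rename[OF E \<sigma> p] \<sigma> p by (auto dest: inj_onD)

section \<open>Labelled graphs of a subgroup\<close>

definition labelled_graphs :: "'a set \<Rightarrow> nat \<Rightarrow> (nat, 'a) edges set" where
  "labelled_graphs A n = {E. admissible A {..<n} E 0}"

lemma finite_labelled_graphs: "finite A \<Longrightarrow> finite (labelled_graphs A n)"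
  by (rule finite_subset[of _ "Pow ({..<n} \<times> A \<times> {..<n})"])
    (auto simp: labelled_graphs_def admissible_def A_graph_def)

lemma loops_subgroups_of_size:
  assumes "finite A" "E \<in> labelled_graphs A n"
  shows "loops E 0 \<in> subgroups_of_size A n"
proof -
  have adm: "admissible A {..<n} E 0" using assms(2) by (simp add: labelled_graphs_def)
  then have "stallings_graph A (loops E 0) {..<n} E 0"
    by (auto simp: stallings_graph_def loops_def carrier_free_group)
  moreover have "card {..<n} = n" by simp
  ultimately show ?thesis
    using finitely_generated_loops[OF adm assms(1)] unfolding subgroups_of_size_def by blast
qed

lemma subgroups_of_size_labelled:
  assumes "H \<in> subgroups_of_size A n"
  shows "\<exists>E\<in>labelled_graphs A n. loops E 0 = H"
proof -
  obtain V :: "nat set" and E p where st: "stallings_graph A H V E p" and n: "card V = n"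
    and fg: "finitely_generated_subgroup H A"
    using assms by (auto simp: subgroups_of_size_def)
  have adm: "admissible A V E p" using st by (simp add: stallings_graph_def)
  then have E: "A_graph A V E" and V: "finite V" "p \<in> V" by (auto simp: admissible_def)
  have "H \<subseteq> carrier (free_group A)"
    using fg by (auto simp: finitely_generated_subgroup_def dest: subgroup.subset)
  with st loops_carrier[OF E, of p] have H: "H = loops E p"
    by (auto simp: stallings_graph_def loops_def carrier_free_group)
  obtain h where h: "bij_betw h V {..<n}"
    using ex_bij_betw_finite_nat[OF V(1)] n by (auto simp: atLeast0LessThan)
  have hp: "h p < n" using h V(2) by (auto simp: bij_betw_def)
  \<comment> \<open>The transposition moves the base vertex to \<open>0\<close>.\<close>
  define \<sigma> where "\<sigma> = Transposition.transpose (h p) 0 \<circ> h"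
  have "Transposition.transpose (h p) 0 permutes {..<n}" using hp by (intro permutes_swap_id) auto
  then have \<sigma>: "bij_betw \<sigma> V {..<n}" unfolding \<sigma>_def
    by (intro bij_betw_trans[OF h] permutes_imp_bij)
  have \<sigma>p: "\<sigma> p = 0" by (simp add: \<sigma>_def)
  have "rename \<sigma> E \<in> labelled_graphs A n"
    using admissible_rename[OF adm \<sigma>] \<sigma>p by (simp add: labelled_graphs_def)
  moreover have "loops (rename \<sigma> E) 0 = H"
    using loops_rename[OF E _ V(2), of \<sigma>] \<sigma> \<sigma>p H by (simp add: bij_betw_def)
  ultimately show ?thesis by blast
qed

text \<open>An isomorphism that fixes the base vertex is determined, since each vertex is the end of a word read
from the base vertex. This is why renaming a graph by different permutations gives different labelled
graphs.\<close>

lemma rename_rigid: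
  assumes adm: "admissible A V E p" and "bij_betw \<sigma> V V" "bij_betw \<tau> V V" "\<sigma> p = \<tau> p"
    and eq: "rename \<sigma> E = rename \<tau> E" and x: "x \<in> V"
  shows "\<sigma> x = \<tau> x"
proof -
  have E: "A_graph A V E" and p: "p \<in> V" and C: "connected_graph V E"
    using adm by (auto simp: admissible_def)
  have i: "inj_on \<sigma> V" "inj_on \<tau> V" using assms by (auto simp: bij_betw_def)
  obtain w where w: "read_word E p w x" using connected_read[OF E C p x] by blast
  have "read_word (rename \<sigma> E) (\<sigma> p) w (\<sigma> x)" using read_word_rename[OF E i(1) p] w x by blast
  moreover have "read_word (rename \<sigma> E) (\<sigma> p) w (\<tau> x)"
    using read_word_rename[OF E i(2) p] w x assms(4) eq by auto
  ultimately show ?thesis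
    using read_word_det[OF A_graph_rename[OF E assms(2)]] by blast
qed

text \<open>By uniqueness of the Stallings graph, the permutations that fix the base vertex act transitively on the
labelled graphs of a subgroup, and by rigidity they act freely.\<close>

lemma card_labelled_graphs_fibre:
  assumes E: "E \<in> labelled_graphs A n"
  shows "card {E' \<in> labelled_graphs A n. loops E' 0 = loops E 0} = fact (n - 1)"
proof -
  have adm: "admissible A {..<n} E 0" using E by (simp add: labelled_graphs_def)
  then have G: "A_graph A {..<n} E" and n: "0 < n" by (auto simp: admissible_def)
  have perm: "bij_betw \<sigma> {..<n} {..<n} \<and> \<sigma> 0 = 0" if "\<sigma> permutes {1..<n}" for \<sigma>
  proof
    have "\<sigma> permutes {..<n}" using that by (rule permutes_subset) auto
    then show "bij_betw \<sigma> {..<n} {..<n}" by (rule permutes_imp_bij)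
    show "\<sigma> 0 = 0" using that by (rule permutes_not_in) simp
  qed
  have "bij_betw (\<lambda>\<sigma>. rename \<sigma> E) {\<sigma>. \<sigma> permutes {1..<n}}
      {E' \<in> labelled_graphs A n. loops E' 0 = loops E 0}"
    unfolding bij_betw_def
  proof (intro conjI subset_antisym subsetI)
    show "inj_on (\<lambda>\<sigma>. rename \<sigma> E) {\<sigma>. \<sigma> permutes {1..<n}}"
    proof (rule inj_onI, rule ext)
      fix \<sigma> \<tau> x assume *: "\<sigma> \<in> {\<sigma>. \<sigma> permutes {1..<n}}" "\<tau> \<in> {\<sigma>. \<sigma> permutes {1..<n}}"
        "rename \<sigma> E = rename \<tau> E"
      show "\<sigma> x = \<tau> x"
      proof (cases "x < n")
        case True
        then show ?thesis
          using rename_rigid[OF adm, of \<sigma> \<tau> x] perm[of \<sigma>] perm[of \<tau>] * by simp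
      next
        case False
        then show ?thesis using * by (simp add: permutes_not_in)
      qed
    qed
  next
    fix E' assume "E' \<in> (\<lambda>\<sigma>. rename \<sigma> E) ` {\<sigma>. \<sigma> permutes {1..<n}}"
    then obtain \<sigma> where \<sigma>: "\<sigma> permutes {1..<n}" "E' = rename \<sigma> E" by auto
    then show "E' \<in> {E' \<in> labelled_graphs A n. loops E' 0 = loops E 0}"
      using perm[OF \<sigma>(1)] admissible_rename[OF adm, of \<sigma> "{..<n}"] loops_rename[OF G, of \<sigma> 0] n
      by (auto simp: labelled_graphs_def bij_betw_def)
  next
    fix E' assume E': "E' \<in> {E' \<in> labelled_graphs A n. loops E' 0 = loops E 0}"
    then obtain \<sigma> where \<sigma>: "bij_betw \<sigma> {..<n} {..<n}" "\<sigma> 0 = 0" "rename \<sigma> E = E'"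
      using stallings_graph_unique[OF adm, of "{..<n}" E' 0] by (auto simp: labelled_graphs_def)
    define \<tau> where "\<tau> = (\<lambda>x. if x < n then \<sigma> x else x)"
    have \<tau>: "bij_betw \<tau> {..<n} {..<n}"
      using \<sigma>(1) by (subst bij_betw_cong[of _ _ \<sigma>]) (auto simp: \<tau>_def)
    have "\<tau> permutes {..<n}" using \<tau> by (rule bij_imp_permutes) (auto simp: \<tau>_def)
    then have "\<tau> permutes {1..<n}"
    proof (rule permutes_superset)
      fix x assume "x \<in> {..<n} - {1..<n}"
      then have "x = 0" by auto
      then show "\<tau> x = x" using \<sigma>(2) n by (simp add: \<tau>_def)
    qed
    moreover have "rename \<tau> E = rename \<sigma> E"
      unfolding rename_def using G by (intro image_cong) (auto simp: A_graph_def \<tau>_def)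
    ultimately show "E' \<in> (\<lambda>\<sigma>. rename \<sigma> E) ` {\<sigma>. \<sigma> permutes {1..<n}}"
      using \<sigma>(3) by auto
  qed
  then have "card {E' \<in> labelled_graphs A n. loops E' 0 = loops E 0} = card {\<sigma>. \<sigma> permutes {1..<n}}"
    by (simp add: bij_betw_same_card)
  also have "\<dots> = fact (n - 1)" by (rule card_permutations) auto
  finally show ?thesis .
qed

lemma subgroups_of_size_eq_image:
  "finite A \<Longrightarrow> subgroups_of_size A n = (\<lambda>E. loops E 0) ` labelled_graphs A n"
  using loops_subgroups_of_size subgroups_of_size_labelled by blast

lemma card_labelled_property:
  assumes A: "finite A"
  shows "card {E \<in> labelled_graphs A n. P (loops E 0)} =
    fact (n - 1) * card {H \<in> subgroups_of_size A n. P H}"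
proof -
  let ?f = "\<lambda>E. loops E (0::nat)"
  let ?L = "{E \<in> labelled_graphs A n. P (?f E)}"
  have im: "?f ` ?L = {H \<in> subgroups_of_size A n. P H}"
    using subgroups_of_size_eq_image[OF A, of n] by auto
  have "card ?L = (\<Sum>H\<in>?f ` ?L. \<Sum>E\<in>{E. E \<in> ?L \<and> ?f E = H}. 1)"
    using finite_labelled_graphs[OF A, of n] by (subst sum.image_gen[symmetric]) auto
  also have "\<dots> = (\<Sum>H\<in>?f ` ?L. fact (n - 1))"
  proof (rule sum.cong[OF refl])
    fix H assume "H \<in> ?f ` ?L"
    then obtain E where E: "E \<in> labelled_graphs A n" "P (?f E)" "H = ?f E" by auto
    then have "{E'. E' \<in> ?L \<and> ?f E' = H} = {E' \<in> labelled_graphs A n. ?f E' = ?f E}" by auto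
    then show "(\<Sum>E\<in>{E. E \<in> ?L \<and> ?f E = H}. 1) = fact (n - 1)"
      using card_labelled_graphs_fibre[OF E(1)] by simp
  qed
  finally show ?thesis unfolding im by simp
qed

section \<open>Purity and cycles\<close>

definition letter_rel :: "('v, 'a) edges \<Rightarrow> 'a \<Rightarrow> ('v \<times> 'v) set" where
  "letter_rel E a = {(x, y). (x, a, y) \<in> E}"

lemma trancl_letter_rel:
  "(x, y) \<in> (letter_rel E a)\<^sup>+ \<Longrightarrow> \<exists>k>0. read_word E x (replicate k (a, True)) y"
proof (induction rule: trancl_induct)
  case (base y)
  then show ?case by (intro exI[of _ 1]) (auto simp: letter_rel_def)
next
  case (step y z)
  then obtain k where "read_word E x (replicate k (a, True)) y" by blast
  then have "read_word E x (replicate k (a, True) @ [(a, True)]) z"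
    using step by (auto simp: read_word_append letter_rel_def)
  then have "read_word E x (replicate (Suc k) (a, True)) z"
    by (simp only: replicate_append_same[symmetric] replicate_Suc)
  then show ?case by blast
qed

text \<open>The inner parts \<open>u\<inverse> u\<close> of the power of a conjugate cancel.\<close>

lemma conjugate_pow:
  "(free_reduce (u @ [l] @ inv_word u)) [^]\<^bsub>free_group A\<^esub> (k::nat) =
    free_reduce (u @ replicate k l @ inv_word u)"
proof (induction k)
  case 0
  show ?case by (simp add: one_free_group foldr_push_inv_word_right)
next
  case (Suc k)
  have "(free_reduce (u @ [l] @ inv_word u)) [^]\<^bsub>free_group A\<^esub> Suc k =
      free_reduce ((u @ replicate k l @ inv_word u) @ (u @ [l] @ inv_word u))"
    by (simp only: nat_pow_Suc Suc.IH free_reduce_mult)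
  also have "\<dots> = free_reduce (u @ (replicate k l @ [l]) @ inv_word u)"
    by (simp add: foldr_push_inv_word_left reduced_push reduced_foldr_push)
  finally show ?case by (simp only: replicate_append_same[symmetric] replicate_Suc)
qed

lemma pure_no_long_cycle:
  assumes adm: "admissible A V E p" and pure: "pure_subgroup (loops E p) A"
    and cyc: "(x, x) \<in> (letter_rel E a)\<^sup>+"
  shows "(x, x) \<in> letter_rel E a"
proof -
  have E: "A_graph A V E" and p: "p \<in> V" and C: "connected_graph V E"
    using adm by (auto simp: admissible_def)
  obtain y where "(x, y) \<in> letter_rel E a" using cyc by (auto dest: tranclD)
  then have x: "x \<in> V" "a \<in> A" using E by (auto simp: letter_rel_def A_graph_def)
  obtain k where k: "k > 0" "read_word E x (replicate k (a, True)) x"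
    using trancl_letter_rel[OF cyc] by blast
  obtain u where u: "reduced u" "read_word E p u x" using connected_read[OF E C p x(1)] by blast
  define g where "g = free_reduce (u @ [(a, True)] @ inv_word u)"
  have "fst ` set u \<subseteq> A" using read_word_closed(1)[OF E u(2)] .
  then have "fst ` set (u @ [(a, True)] @ inv_word u) \<subseteq> A"
    unfolding set_append image_Un fst_set_inv_word using x by simp
  then have "g \<in> carrier (free_group A)" unfolding g_def by (rule free_reduce_carrier)
  moreover have "g [^]\<^bsub>free_group A\<^esub> int k \<in> loops E p"
  proof -
    have "read_word E p (u @ replicate k (a, True) @ inv_word u) p"
      using u k by (auto simp: read_word_append read_inv_word)
    then have "read_word E p (free_reduce (u @ replicate k (a, True) @ inv_word u)) p"
      by (rule read_free_reduce[OF E])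
    moreover have "reduced (free_reduce (u @ replicate k (a, True) @ inv_word u))"
      by (rule reduced_foldr_push) simp
    ultimately show ?thesis
      unfolding int_pow_int g_def conjugate_pow loops_def by blast
  qed
  ultimately have "g \<in> loops E p"
    using pure k(1) unfolding pure_subgroup_def by (metis of_nat_0_less_iff less_irrefl)
  \<comment> \<open>Undoing the conjugation turns the loop \<open>g\<close> at \<open>p\<close> into a loop at \<open>x\<close> that reduces to \<open>a\<close>.\<close>
  then have "read_word E x (inv_word u @ g @ u) x"
    using u by (auto simp: read_word_append read_inv_word loops_def)
  then have "read_word E x (free_reduce (inv_word u @ g @ u)) x"
    by (rule read_free_reduce[OF E])
  also have "free_reduce (inv_word u @ g @ u) = [(a, True)]"
  proof -
    have "foldr push g u = push' " if "push' = foldr push u [(a, True)]" for push'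
      unfolding g_def using foldr_push_free_reduce[OF u(1), of "u @ [(a, True)] @ inv_word u"]
        foldr_push_inv_word_left[of "[]" u] u(1) that by (simp add: foldr_push_Nil)
    then show ?thesis using u(1) by (simp add: foldr_push_Nil foldr_push_inv_word_left)
  qed
  finally show ?thesis by (simp add: letter_rel_def)
qed

section \<open>Partial injections by number of edges\<close>

definition partial_injections :: "'v set \<Rightarrow> ('v \<times> 'v) set set" where
  "partial_injections S = {R. R \<subseteq> S \<times> S \<and> single_valued R \<and> single_valued (R\<inverse>)}"

definition sized_injections :: "'v set \<Rightarrow> nat \<Rightarrow> ('v \<times> 'v) set set" where
  "sized_injections S m = {R \<in> partial_injections S. card R = m}"

lemma Suc_times_binomial_Suc: "Suc k * (n choose Suc k) = (n - k) * (n choose k)"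
proof (cases n)
  case (Suc n')
  have "Suc k * (n choose Suc k) = n * (n' choose k)"
    unfolding Suc by (rule Suc_times_binomial)
  also have "\<dots> = (n - k) * (n choose k)"
    using binomial_absorb_comp[of n k] unfolding Suc by simp
  finally show ?thesis .
qed simp

text \<open>These are the pairs that can be added to \<open>R\<close> without losing injectivity or single-valuedness.\<close>

definition open_pairs :: "'v set \<Rightarrow> ('v \<times> 'v) set \<Rightarrow> ('v \<times> 'v) set" where
  "open_pairs S R = (S - Domain R) \<times> (S - Range R)"

lemma finite_partial_injections: "finite S \<Longrightarrow> finite (partial_injections S)"
  by (rule finite_subset[of _ "Pow (S \<times> S)"]) (auto simp: partial_injections_def)

lemma finite_sized_injections: "finite S \<Longrightarrow> finite (sized_injections S m)"
  using finite_partial_injections[of S] by (simp add: sized_injections_def)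

lemma partial_injections_finite: "finite S \<Longrightarrow> R \<in> partial_injections S \<Longrightarrow> finite R"
  by (auto simp: partial_injections_def intro: finite_subset)

lemma partial_injections_remove: "R \<in> partial_injections S \<Longrightarrow> R - X \<in> partial_injections S"
  by (auto simp: partial_injections_def intro: single_valued_subset[of "R - X" R]
      single_valued_subset[of "(R - X)\<inverse>" "R\<inverse>"])

lemma partial_injections_insert:
  "R \<in> partial_injections S \<Longrightarrow> e \<in> open_pairs S R \<Longrightarrow> insert e R \<in> partial_injections S"
  unfolding partial_injections_def single_valued_def open_pairs_def by auto

lemma open_pairs_remove:
  assumes "R \<in> partial_injections S" "e \<in> R"
  shows "e \<in> open_pairs S (R - {e})"
proof -
  obtain x y where e: "e = (x, y)" by (cases e)
  have "x \<in> S" "y \<in> S" using assms e by (auto simp: partial_injections_def)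
  moreover have "z = y" if "(x, z) \<in> R" for z
    using assms that by (auto simp: e partial_injections_def dest: single_valuedD)
  moreover have "z = x" if "(z, y) \<in> R" for z
    using assms that by (auto simp: e partial_injections_def dest: single_valuedD)
  ultimately show ?thesis by (auto simp: e open_pairs_def)
qed

lemma card_Domain_partial_injection:
  assumes "R \<in> partial_injections S" shows "card (Domain R) = card R"
proof -
  have "inj_on fst R" using assms
    by (auto simp: partial_injections_def single_valued_def inj_on_def)
  then show ?thesis by (simp add: Domain_fst card_image)
qed

lemma card_Range_partial_injection:
  assumes "R \<in> partial_injections S" shows "card (Range R) = card R"
proof -
  have "inj_on snd R" using assms
    by (auto simp: partial_injections_def single_valued_def inj_on_def)
  then show ?thesis by (simp add: Range_snd card_image)
qed

lemma card_missing:
  assumes "finite S" "R \<in> partial_injections S"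
  shows "card (S - Domain R) = card S - card R" "card (S - Range R) = card S - card R"
proof -
  have "Domain R \<subseteq> S" "Range R \<subseteq> S" using assms(2) by (auto simp: partial_injections_def)
  then show "card (S - Domain R) = card S - card R" "card (S - Range R) = card S - card R"
    using assms by (simp_all add: card_Diff_subset finite_subset card_Domain_partial_injection
        card_Range_partial_injection)
qed

lemma card_le_partial_injection:
  assumes "finite S" "R \<in> partial_injections S" shows "card R \<le> card S"
  using card_mono[OF assms(1), of "Domain R"] assms(2) card_Domain_partial_injection[OF assms(2)]
  by (auto simp: partial_injections_def)

text \<open>Both sides count the pairs of a member of \<open>X\<close> with \<open>m + 1\<close> edges and one of its edges, the right-hand
side after removing that edge. The family \<open>X\<close> will be that of all partial injections, then that of the
acyclic ones.\<close>

lemma card_marked_edges: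
  assumes S: "finite S" and X: "X \<subseteq> partial_injections S"
    and closed: "\<And>R e. R \<in> X \<Longrightarrow> R - {e} \<in> X"
  shows "Suc m * card {R \<in> X. card R = Suc m} =
    (\<Sum>R\<in>{R \<in> X. card R = m}. card {e \<in> open_pairs S R. insert e R \<in> X})"
proof -
  have finX: "finite X" using finite_subset[OF X finite_partial_injections[OF S]] .
  have finR: "finite R" if "R \<in> X" for R using partial_injections_finite[OF S] that X by blast
  have finO: "finite (open_pairs S R)" for R using S by (simp add: open_pairs_def)
  have "Suc m * card {R \<in> X. card R = Suc m} = (\<Sum>R\<in>{R \<in> X. card R = Suc m}. card R)"
    by simp
  also have "\<dots> = card (SIGMA R:{R \<in> X. card R = Suc m}. R)"
    using finX finR by (subst card_SigmaI) auto
  also have "\<dots> = card (SIGMA R:{R \<in> X. card R = m}. {e \<in> open_pairs S R. insert e R \<in> X})"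
  proof (rule bij_betw_same_card[of "\<lambda>(R, e). (R - {e}, e)"],
      rule bij_betw_byWitness[where f' = "\<lambda>(R, e). (insert e R, e)"])
    show "\<forall>a\<in>SIGMA R:{R \<in> X. card R = Suc m}. R.
        (\<lambda>(R, e). (insert e R, e)) ((\<lambda>(R, e). (R - {e}, e)) a) = a"
      by auto
    show "\<forall>a\<in>SIGMA R:{R \<in> X. card R = m}. {e \<in> open_pairs S R. insert e R \<in> X}.
        (\<lambda>(R, e). (R - {e}, e)) ((\<lambda>(R, e). (insert e R, e)) a) = a"
      by (auto simp: open_pairs_def)
    show "(\<lambda>(R, e). (R - {e}, e)) ` (SIGMA R:{R \<in> X. card R = Suc m}. R)
        \<subseteq> (SIGMA R:{R \<in> X. card R = m}. {e \<in> open_pairs S R. insert e R \<in> X})"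
    proof (rule image_subsetI)
      fix q assume q: "q \<in> (SIGMA R:{R \<in> X. card R = Suc m}. R)"
      obtain R e where [simp]: "q = (R, e)" by (cases q)
      have "R \<in> X" "card R = Suc m" "e \<in> R" using q by auto
      then show "(\<lambda>(R, e). (R - {e}, e)) q
          \<in> (SIGMA R:{R \<in> X. card R = m}. {e \<in> open_pairs S R. insert e R \<in> X})"
        using open_pairs_remove[of R S e] X closed finR by (auto simp: insert_absorb)
    qed
    show "(\<lambda>(R, e). (insert e R, e)) `
        (SIGMA R:{R \<in> X. card R = m}. {e \<in> open_pairs S R. insert e R \<in> X})
        \<subseteq> (SIGMA R:{R \<in> X. card R = Suc m}. R)"
    proof (rule image_subsetI)
      fix q assume q: "q \<in> (SIGMA R:{R \<in> X. card R = m}. {e \<in> open_pairs S R. insert e R \<in> X})"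
      obtain R e where [simp]: "q = (R, e)" by (cases q)
      have "R \<in> X" "card R = m" "e \<in> open_pairs S R" "insert e R \<in> X" using q by auto
      moreover from this have "e \<notin> R" by (auto simp: open_pairs_def)
      ultimately show "(\<lambda>(R, e). (insert e R, e)) q \<in> (SIGMA R:{R \<in> X. card R = Suc m}. R)"
        using finR by auto
    qed
  qed
  also have "\<dots> = (\<Sum>R\<in>{R \<in> X. card R = m}. card {e \<in> open_pairs S R. insert e R \<in> X})"
    using finX finO by (intro card_SigmaI) auto
  finally show ?thesis .
qed

lemma card_open_pairs:
  assumes "finite S" "R \<in> sized_injections S m" shows "card (open_pairs S R) = (card S - m)\<^sup>2"
  using assms card_missing[of S R]
  by (simp add: open_pairs_def card_cartesian_product sized_injections_def power2_eq_square)

lemma card_sized_injections_Suc: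
  assumes S: "finite S"
  shows "Suc m * card (sized_injections S (Suc m)) = (card S - m)\<^sup>2 * card (sized_injections S m)"
proof -
  have "Suc m * card (sized_injections S (Suc m)) =
      (\<Sum>R\<in>sized_injections S m. card {e \<in> open_pairs S R. insert e R \<in> partial_injections S})"
    unfolding sized_injections_def
    by (rule card_marked_edges[OF S subset_refl]) (rule partial_injections_remove)
  also have "\<dots> = (\<Sum>R\<in>sized_injections S m. (card S - m)\<^sup>2)"
  proof (rule sum.cong[OF refl])
    fix R assume R: "R \<in> sized_injections S m"
    then have "{e \<in> open_pairs S R. insert e R \<in> partial_injections S} = open_pairs S R"
      using partial_injections_insert by (auto simp: sized_injections_def)
    then show "card {e \<in> open_pairs S R. insert e R \<in> partial_injections S} = (card S - m)\<^sup>2"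
      using card_open_pairs[OF S R] by simp
  qed
  finally show ?thesis by simp
qed

text \<open>Following edges in a finite acyclic relation must stop.\<close>

lemma exists_chain_end:
  assumes "finite R" "acyclic R" "R \<subseteq> S \<times> S" "y \<in> S"
  shows "\<exists>x\<in>S - Domain R. (y, x) \<in> R\<^sup>*"
proof -
  have "wf (R\<inverse>)" by (rule finite_acyclic_wf_converse[OF assms(1,2)])
  then show ?thesis using assms(4)
  proof (induction y rule: wf_induct_rule)
    case (less y)
    show ?case
    proof (cases "y \<in> Domain R")
      case True
      then obtain z where z: "(y, z) \<in> R" by auto
      with assms(3) have "z \<in> S" by auto
      with less.IH[of z] z obtain x where "x \<in> S - Domain R" "(z, x) \<in> R\<^sup>*" by auto
      with z show ?thesis by (meson converse_rtrancl_into_rtrancl)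
    qed (use less.prems in auto)
  qed
qed

text \<open>Of the \<open>k\<^sup>2\<close> pairs of a path end and a path start, those that join a path to itself close a cycle, and
every start leads to an end.\<close>

lemma card_acyclic_extensions:
  assumes S: "finite S" and R: "R \<in> sized_injections S m" "acyclic R"
  shows "card {e \<in> open_pairs S R. insert e R \<in> {R \<in> partial_injections S. acyclic R}}
    \<le> (card S - m) * (card S - m - 1)"
proof -
  have Ri: "R \<in> partial_injections S" "card R = m" using R by (auto simp: sized_injections_def)
  then have RS: "R \<subseteq> S \<times> S" by (auto simp: partial_injections_def)
  note k = card_missing[OF S Ri(1), unfolded Ri(2)]
  let ?Q = "SIGMA y:S - Range R. {x \<in> S - Domain R. (y, x) \<notin> R\<^sup>*}"
  have "{e \<in> open_pairs S R. insert e R \<in> {R \<in> partial_injections S. acyclic R}} \<subseteq> prod.swap ` ?Q"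
  proof
    fix e assume e: "e \<in> {e \<in> open_pairs S R. insert e R \<in> {R \<in> partial_injections S. acyclic R}}"
    obtain x y where [simp]: "e = (x, y)" by (cases e)
    have "(y, x) \<notin> R\<^sup>*" using e by (simp add: acyclic_insert)
    with e have "(y, x) \<in> ?Q" by (auto simp: open_pairs_def)
    then show "e \<in> prod.swap ` ?Q" by (rule rev_image_eqI) simp
  qed
  then have "card {e \<in> open_pairs S R. insert e R \<in> {R \<in> partial_injections S. acyclic R}} \<le> card ?Q"
    using S by (intro surj_card_le) auto
  also have "\<dots> = (\<Sum>y\<in>S - Range R. card {x \<in> S - Domain R. (y, x) \<notin> R\<^sup>*})"
    using S by (intro card_SigmaI) auto
  also have "\<dots> \<le> (\<Sum>y\<in>S - Range R. card S - m - 1)"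
  proof (rule sum_mono)
    fix y assume "y \<in> S - Range R"
    then obtain x where x: "x \<in> S - Domain R" "(y, x) \<in> R\<^sup>*"
      using exists_chain_end[OF partial_injections_finite[OF S Ri(1)] R(2) RS] by blast
    have "card {x \<in> S - Domain R. (y, x) \<notin> R\<^sup>*} \<le> card (S - Domain R - {x})"
      using S x by (intro card_mono) auto
    also have "\<dots> = card S - m - 1" using x S k by simp
    finally show "card {x \<in> S - Domain R. (y, x) \<notin> R\<^sup>*} \<le> card S - m - 1" .
  qed
  also have "\<dots> = (card S - m) * (card S - m - 1)" using k by simp
  finally show ?thesis .
qed

text \<open>At most a fraction \<open>k / n\<close> of the partial injections with \<open>k = n - m\<close> paths is acyclic. When an edge is
added, the numbers of both kinds grow by factors whose ratio is at most \<open>(k - 1) / k\<close>, and the product of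
these ratios telescopes.\<close>

lemma card_acyclic_sized_injections:
  assumes S: "finite S"
  shows "card S * card {R \<in> sized_injections S m. acyclic R} \<le> (card S - m) * card (sized_injections S m)"
proof (induction m)
  case 0
  have "card {R \<in> sized_injections S 0. acyclic R} \<le> card (sized_injections S 0)"
    using finite_sized_injections[OF S] by (intro card_mono) auto
  then show ?case by simp
next
  case (Suc m)
  let ?X = "{R \<in> partial_injections S. acyclic R}"
  let ?k = "card S - m"
  have *: "{R \<in> sized_injections S m. acyclic R} = {R \<in> ?X. card R = m}" for m by (auto simp: sized_injections_def)
  have "Suc m * card {R \<in> ?X. card R = Suc m} =
      (\<Sum>R\<in>{R \<in> ?X. card R = m}. card {e \<in> open_pairs S R. insert e R \<in> ?X})"
  proof (rule card_marked_edges[OF S])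
    fix R e assume "R \<in> ?X"
    then show "R - {e} \<in> ?X"
      using partial_injections_remove[of R S "{e}"] acyclic_subset[of R "R - {e}"] by auto
  qed auto
  also have "\<dots> \<le> (\<Sum>R\<in>{R \<in> ?X. card R = m}. ?k * (?k - 1))"
    using card_acyclic_extensions[OF S] by (intro sum_mono) (auto simp: sized_injections_def)
  finally have "Suc m * card {R \<in> sized_injections S (Suc m). acyclic R}
      \<le> card {R \<in> sized_injections S m. acyclic R} * (?k * (?k - 1))"
    unfolding * by simp
  then have "Suc m * (card S * card {R \<in> sized_injections S (Suc m). acyclic R})
      \<le> (card S * card {R \<in> sized_injections S m. acyclic R}) * (?k * (?k - 1))"
    by (metis (no_types, lifting) mult.assoc mult.left_commute mult_le_mono2)
  also have "\<dots> \<le> (?k * card (sized_injections S m)) * (?k * (?k - 1))"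
    using Suc.IH by (rule mult_le_mono1)
  also have "\<dots> = (?k - 1) * (?k\<^sup>2 * card (sized_injections S m))"
    by (simp only: power2_eq_square mult_ac)
  also have "\<dots> = (card S - Suc m) * (Suc m * card (sized_injections S (Suc m)))"
    unfolding card_sized_injections_Suc[OF S] by simp
  also have "\<dots> = Suc m * ((card S - Suc m) * card (sized_injections S (Suc m)))"
    by (simp only: mult_ac)
  finally show ?case by (simp only: Suc_mult_le_cancel1)
qed

lemma card_sized_injections:
  assumes S: "finite S"
  shows "card (sized_injections S m) = (card S choose m)\<^sup>2 * fact m"
proof (induction m)
  case 0
  have "{} \<in> sized_injections S 0" by (simp add: sized_injections_def partial_injections_def single_valued_def)
  moreover have "R = {}" if "R \<in> sized_injections S 0" for R
    using that partial_injections_finite[OF S, of R] by (simp add: sized_injections_def)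
  ultimately have "sized_injections S 0 = {{}}" by blast
  then show ?case by simp
next
  case (Suc m)
  have *: "Suc m * (card S choose Suc m) = (card S - m) * (card S choose m)"
    by (rule Suc_times_binomial_Suc)
  have "Suc m * card (sized_injections S (Suc m)) = ((card S - m) * (card S choose m))\<^sup>2 * fact m"
    unfolding card_sized_injections_Suc[OF S] Suc.IH by (simp add: power_mult_distrib)
  also have "\<dots> = Suc m * ((card S choose Suc m)\<^sup>2 * fact (Suc m))"
    unfolding *[symmetric] by (simp only: power2_eq_square fact_Suc of_nat_id mult_ac)
  finally show ?case by (simp only: Suc_mult_cancel1)
qed

section \<open>Moments of the number of paths\<close>

text \<open>A partial injection of an \<open>n\<close>-set with \<open>k\<close> points outside its domain has \<open>n - k\<close> edges; the weight is
the number of such partial injections, divided by \<open>n!\<close>. So normalised, the total is monotone in \<open>n\<close>.\<close>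

definition deficit_weight :: "nat \<Rightarrow> nat \<Rightarrow> real" where
  "deficit_weight n k = real (n choose k) / fact k"

text \<open>The coefficient of \<open>z\<^sup>n\<close> in \<open>exp (z / (1 - z)) / (1 - z)\<close>, the exponential generating function of partial
injections.\<close>

definition injection_coeff :: "nat \<Rightarrow> real" where
  "injection_coeff n = (\<Sum>k\<le>n. deficit_weight n k)"

lemma card_sized_injections_weight:
  assumes S: "finite S" and k: "k \<le> card S"
  shows "real (card (sized_injections S (card S - k))) = fact (card S) * deficit_weight (card S) k"
proof -
  let ?n = "card S"
  have "real (card (sized_injections S (?n - k))) = real (?n choose k) * (real (?n choose k) * fact (?n - k))"
    using card_sized_injections[OF S, of "?n - k"] binomial_symmetric[OF k]
    by (simp add: power2_eq_square)
  also have "real (?n choose k) * fact (?n - k) = fact ?n / fact k"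
    using binomial_fact[OF k, where 'a = real] by simp
  finally show ?thesis by (simp add: deficit_weight_def)
qed

lemma sum_partial_injections:
  assumes S: "finite S"
  shows "(\<Sum>R\<in>partial_injections S. g (card S - card R)) =
    fact (card S) * (\<Sum>k\<le>card S. (g k :: real) * deficit_weight (card S) k)"
proof -
  let ?n = "card S"
  have "(\<Sum>R\<in>partial_injections S. g (?n - card R)) =
      (\<Sum>k\<le>?n. \<Sum>R\<in>{R \<in> partial_injections S. ?n - card R = k}. g (?n - card R))"
    using finite_partial_injections[OF S] by (intro sum.group[symmetric]) auto
  also have "\<dots> = (\<Sum>k\<le>?n. real (card (sized_injections S (?n - k))) * g k)"
  proof (rule sum.cong[OF refl])
    fix k assume "k \<in> {..?n}"
    then have "{R \<in> partial_injections S. ?n - card R = k} = sized_injections S (?n - k)"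
      using card_le_partial_injection[OF S] by (fastforce simp: sized_injections_def)
    then show "(\<Sum>R\<in>{R \<in> partial_injections S. ?n - card R = k}. g (?n - card R)) =
        real (card (sized_injections S (?n - k))) * g k"
      using \<open>k \<in> {..?n}\<close> by (simp add: sized_injections_def)
  qed
  also have "\<dots> = fact ?n * (\<Sum>k\<le>?n. g k * deficit_weight ?n k)"
    unfolding sum_distrib_left using card_sized_injections_weight[OF S] by (intro sum.cong) auto
  finally show ?thesis .
qed

lemma card_partial_injections:
  "finite S \<Longrightarrow> real (card (partial_injections S)) = fact (card S) * injection_coeff (card S)"
  using sum_partial_injections[of S "\<lambda>_. 1"] by (simp add: injection_coeff_def)

lemma deficit_weight_nonneg: "deficit_weight n k \<ge> 0"
  by (simp add: deficit_weight_def)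

lemma injection_coeff_ge_1: "injection_coeff n \<ge> 1"
proof -
  have "deficit_weight n 0 \<le> injection_coeff n" unfolding injection_coeff_def by (rule member_le_sum) (auto simp: deficit_weight_nonneg)
  then show ?thesis by (simp add: deficit_weight_def)
qed

lemma injection_coeff_mono: "m \<le> n \<Longrightarrow> injection_coeff m \<le> injection_coeff n"
proof -
  assume "m \<le> n"
  have "injection_coeff m \<le> (\<Sum>k\<le>m. deficit_weight n k)"
    unfolding injection_coeff_def deficit_weight_def using \<open>m \<le> n\<close>
    by (intro sum_mono divide_right_mono) (auto intro: binomial_right_mono)
  also have "\<dots> \<le> injection_coeff n"
    unfolding injection_coeff_def using \<open>m \<le> n\<close> by (intro sum_mono2) (auto simp: deficit_weight_nonneg)
  finally show ?thesis .
qed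

text \<open>The inequality \<open>E[k\<^sup>2] \<le> n\<close> for a random partial injection: \<open>E[k\<^sup>2]\<close> is the expected number of ways to
add an edge, and this equals the expected number of ways to remove one. On the weights this reads
\<open>k\<^sup>2 w(k) \<le> n w(k - 1)\<close>.\<close>

lemma deficit_second_moment: "(\<Sum>k\<le>n. (real k)\<^sup>2 * deficit_weight n k) \<le> real n * injection_coeff n"
proof (cases n)
  case 0
  then show ?thesis by simp
next
  case (Suc n')
  have "(\<Sum>k\<le>n. (real k)\<^sup>2 * deficit_weight n k) = (\<Sum>k\<le>n'. (real (Suc k))\<^sup>2 * deficit_weight n (Suc k))"
    unfolding Suc by (subst sum.atMost_Suc_shift) simp
  also have "\<dots> \<le> (\<Sum>k\<le>n'. real n * deficit_weight n k)"
  proof (rule sum_mono)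
    fix k
    have "Suc k * (n choose Suc k) = (n - k) * (n choose k)"
      by (rule Suc_times_binomial_Suc)
    also have "\<dots> \<le> n * (n choose k)" by simp
    finally have "real (Suc k) * real (n choose Suc k) \<le> real n * real (n choose k)"
      by (metis of_nat_le_iff of_nat_mult)
    then have "real (Suc k) * real (n choose Suc k) / fact k \<le> real n * real (n choose k) / fact k"
      by (intro divide_right_mono) auto
    moreover have "(real (Suc k))\<^sup>2 * deficit_weight n (Suc k) =
        real (Suc k) * real (n choose Suc k) / fact k"
      by (simp add: deficit_weight_def power2_eq_square field_simps del: of_nat_Suc)
    ultimately show "(real (Suc k))\<^sup>2 * deficit_weight n (Suc k) \<le> real n * deficit_weight n k"
      by (simp add: deficit_weight_def)
  qed
  also have "\<dots> \<le> real n * injection_coeff n"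
    unfolding injection_coeff_def sum_distrib_left[symmetric] using Suc
    by (intro mult_left_mono sum_mono2) (auto simp: deficit_weight_nonneg)
  finally show ?thesis .
qed

lemma deficit_first_moment: "(\<Sum>k\<le>n. real k * deficit_weight n k) \<le> sqrt n * injection_coeff n"
proof (rule power2_le_imp_le)
  \<comment> \<open>Cauchy-Schwarz, with the square roots of the weights split off.\<close>
  have "(\<Sum>k\<le>n. real k * deficit_weight n k)\<^sup>2 =
      (\<Sum>k\<le>n. sqrt (deficit_weight n k) * (real k * sqrt (deficit_weight n k)))\<^sup>2"
    by (intro arg_cong[of _ _ "\<lambda>x. x\<^sup>2"] sum.cong) (auto simp: deficit_weight_nonneg)
  also have "\<dots> \<le> (\<Sum>k\<le>n. (sqrt (deficit_weight n k))\<^sup>2) * (\<Sum>k\<le>n. (real k * sqrt (deficit_weight n k))\<^sup>2)"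
    by (rule Cauchy_Schwarz_ineq_sum)
  also have "\<dots> = injection_coeff n * (\<Sum>k\<le>n. (real k)\<^sup>2 * deficit_weight n k)"
    by (simp add: deficit_weight_nonneg injection_coeff_def power_mult_distrib)
  also have "\<dots> \<le> injection_coeff n * (real n * injection_coeff n)"
    using deficit_second_moment[of n] injection_coeff_ge_1[of n] by (intro mult_left_mono) auto
  also have "\<dots> = (sqrt n * injection_coeff n)\<^sup>2"
    by (simp add: power_mult_distrib power2_eq_square)
  finally show "(\<Sum>k\<le>n. real k * deficit_weight n k)\<^sup>2 \<le> (sqrt n * injection_coeff n)\<^sup>2" .
  show "0 \<le> sqrt n * injection_coeff n" using injection_coeff_ge_1[of n] by simp
qed

text \<open>The coefficient of \<open>z\<^sup>n\<close> in \<open>exp (z / (1 - z))\<close>, which counts sets of disjoint directed paths. At \<open>n = 0\<close>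
the truncated difference \<open>n - 1\<close> is harmless: the sum has the right value \<open>1\<close>. The summand \<open>k\<close> belongs to
\<open>k + 1\<close> paths, and the last one vanishes for positive \<open>n\<close>.\<close>

definition forest_coeff :: "nat \<Rightarrow> real" where
  "forest_coeff n = (\<Sum>k\<le>n. real ((n - 1) choose k) / fact (Suc k))"

text \<open>The weighted number of paths appears because a fraction \<open>k / n\<close> of the partial injections with \<open>k\<close>
paths is acyclic.\<close>

lemma forest_coeff_eq_mean_deficit: "real n * forest_coeff n = (\<Sum>k\<le>n. real k * deficit_weight n k)"
proof (cases n)
  case 0
  then show ?thesis by simp
next
  case (Suc n')
  have "(\<Sum>k\<le>n. real k * deficit_weight n k) = (\<Sum>k\<le>n'. real (Suc k) * deficit_weight n (Suc k))"
    unfolding Suc by (subst sum.atMost_Suc_shift) simp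
  also have "\<dots> = (\<Sum>k\<le>n'. real n * (real (n' choose k) / fact (Suc k)))"
  proof (rule sum.cong[OF refl])
    fix k
    have "Suc k * (n choose Suc k) = n * (n' choose k)"
      unfolding Suc by (rule Suc_times_binomial)
    then have "real (Suc k) * real (n choose Suc k) = real n * real (n' choose k)"
      by (metis of_nat_mult)
    then show "real (Suc k) * deficit_weight n (Suc k) = real n * (real (n' choose k) / fact (Suc k))"
      by (simp add: deficit_weight_def del: of_nat_Suc fact_Suc)
  qed
  also have "\<dots> = real n * forest_coeff n"
    unfolding forest_coeff_def Suc by (simp add: sum_distrib_left binomial_eq_0 del: fact_Suc of_nat_Suc)
  finally show ?thesis ..
qed

lemma forest_coeff_mono: "m \<le> n \<Longrightarrow> forest_coeff m \<le> forest_coeff n"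
proof -
  assume "m \<le> n"
  have "forest_coeff m \<le> (\<Sum>k\<le>m. real ((n - 1) choose k) / fact (Suc k))"
    unfolding forest_coeff_def using \<open>m \<le> n\<close>
    by (intro sum_mono divide_right_mono) (auto intro: binomial_right_mono)
  also have "\<dots> \<le> forest_coeff n"
    unfolding forest_coeff_def using \<open>m \<le> n\<close> by (intro sum_mono2) auto
  finally show ?thesis .
qed

lemma card_acyclic:
  assumes S: "finite S"
  shows "real (card {R \<in> partial_injections S. acyclic R}) \<le> fact (card S) * forest_coeff (card S)"
proof (cases "card S = 0")
  case True
  then have "S = {}" using S by simp
  then have "{R \<in> partial_injections S. acyclic R} \<subseteq> {{}}"
    by (auto simp: partial_injections_def)
  then have "card {R \<in> partial_injections S. acyclic R} \<le> card {{} :: ('a \<times> 'a) set}"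
    by (intro card_mono) auto
  then show ?thesis using True by (simp add: forest_coeff_def)
next
  case False
  let ?n = "card S"
  let ?X = "{R \<in> partial_injections S. acyclic R}"
  have finX: "finite ?X" using finite_partial_injections[OF S] by simp
  have "real (?n * card ?X) = (\<Sum>R\<in>?X. real ?n)" by simp
  also have "\<dots> = (\<Sum>k\<le>?n. \<Sum>R\<in>{R \<in> ?X. ?n - card R = k}. real ?n)"
    using finX by (intro sum.group[symmetric]) auto
  also have "\<dots> \<le> (\<Sum>k\<le>?n. real k * (fact ?n * deficit_weight ?n k))"
  proof (rule sum_mono)
    fix k assume k: "k \<in> {..?n}"
    then have *: "{R \<in> ?X. ?n - card R = k} = {R \<in> sized_injections S (?n - k). acyclic R}"
      using card_le_partial_injection[OF S] by (fastforce simp: sized_injections_def)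
    have "(\<Sum>R\<in>{R \<in> ?X. ?n - card R = k}. real ?n) =
        real (?n * card {R \<in> sized_injections S (?n - k). acyclic R})"
      unfolding * by simp
    also have "\<dots> \<le> real ((?n - (?n - k)) * card (sized_injections S (?n - k)))"
      using card_acyclic_sized_injections[OF S] of_nat_le_iff by blast
    also have "\<dots> = real k * (fact ?n * deficit_weight ?n k)"
      using k card_sized_injections_weight[OF S, of k] by simp
    finally show "(\<Sum>R\<in>{R \<in> ?X. ?n - card R = k}. real ?n) \<le> real k * (fact ?n * deficit_weight ?n k)" .
  qed
  also have "\<dots> = real ?n * (fact ?n * forest_coeff ?n)"
    using forest_coeff_eq_mean_deficit[of ?n] by (simp add: sum_distrib_left algebra_simps)
  finally show ?thesis using False by simp
qed

lemma sum_Pow_card: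
  assumes S: "finite S"
  shows "(\<Sum>T\<in>Pow S. g (card T)) = (\<Sum>j\<le>card S. real (card S choose j) * g j)"
proof -
  have "(\<Sum>T\<in>Pow S. g (card T)) = (\<Sum>j\<le>card S. \<Sum>T\<in>{T \<in> Pow S. card T = j}. g (card T))"
    using S by (intro sum.group[symmetric]) (auto intro: card_mono)
  also have "\<dots> = (\<Sum>j\<le>card S. real (card S choose j) * g j)"
    using n_subsets[OF S] by (intro sum.cong) (auto simp: Pow_def)
  finally show ?thesis .
qed

lemma sum_power_fact_le_exp: "t \<ge> 0 \<Longrightarrow> (\<Sum>j\<le>n. t ^ j / fact j) \<le> exp (t::real)"
proof -
  assume t: "t \<ge> 0"
  have "(\<lambda>j. t ^ j / fact j) sums exp t"
    using exp_converges[of t] by (simp add: divide_inverse mult.commute)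
  then have sm: "summable (\<lambda>j. t ^ j / fact j)" and eq: "(\<Sum>j. t ^ j / fact j) = exp t"
    by (auto simp: sums_iff)
  show ?thesis
    unfolding eq[symmetric] using t by (intro sum_le_suminf[OF sm]) auto
qed

section \<open>Partial injections whose cycles are fixed points\<close>

definition only_fixed_cycles :: "('v \<times> 'v) set \<Rightarrow> bool" where
  "only_fixed_cycles R \<longleftrightarrow> (\<forall>x. (x, x) \<in> R\<^sup>+ \<longrightarrow> (x, x) \<in> R)"

text \<open>Removing the set \<open>T\<close> of fixed points leaves an acyclic partial injection of the complement. Since
\<open>forest_coeff\<close> is monotone, the contribution of all \<open>T\<close> with \<open>j\<close> elements is at most \<open>1 / j!\<close> times the bound
for the acyclic partial injections of the whole set, and summation over \<open>j\<close> gives the factor \<open>e\<close>.\<close>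

lemma card_only_fixed_cycles:
  assumes S: "finite S" and n: "card S > 0"
  shows "real (card {R \<in> partial_injections S. only_fixed_cycles R})
    \<le> exp 1 / sqrt (card S) * real (card (partial_injections S))"
proof -
  let ?n = "card S"
  let ?G = "{R \<in> partial_injections S. only_fixed_cycles R}"
  let ?F = "\<lambda>S. {R \<in> partial_injections S. acyclic R}"
  let ?f = "\<lambda>R. ({x. (x, x) \<in> R}, R - Id)"
  have finF: "finite (?F (S - T))" for T
    using finite_partial_injections[of "S - T"] S by simp
  have "?f ` ?G \<subseteq> (SIGMA T:Pow S. ?F (S - T))"
  proof (rule image_subsetI)
    fix R assume R: "R \<in> ?G"
    have sv: "\<And>x y z. (x, y) \<in> R \<Longrightarrow> (x, z) \<in> R \<Longrightarrow> y = z"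
      "\<And>x y z. (y, x) \<in> R \<Longrightarrow> (z, x) \<in> R \<Longrightarrow> y = z" and RS: "R \<subseteq> S \<times> S"
      using R by (auto simp: partial_injections_def single_valued_def)
    have "R - Id \<in> partial_injections (S - {x. (x, x) \<in> R})"
      unfolding partial_injections_def single_valued_def using sv RS by auto
    moreover have "acyclic (R - Id)"
    proof (rule acyclicI, intro allI notI)
      fix x assume x: "(x, x) \<in> (R - Id)\<^sup>+"
      then have "(x, x) \<in> R\<^sup>+" using trancl_mono[of _ "R - Id" R] by blast
      then have "(x, x) \<in> R" using R by (auto simp: only_fixed_cycles_def)
      moreover obtain y where "(x, y) \<in> R - Id" using x by (auto dest: tranclD)
      ultimately show False using sv(1)[of x x y] by auto
    qed
    ultimately show "?f R \<in> (SIGMA T:Pow S. ?F (S - T))" using RS by auto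
  qed
  moreover have "inj_on ?f ?G"
  proof (rule inj_onI)
    fix R R' :: "('a \<times> 'a) set" assume "?f R = ?f R'"
    then have "{x. (x, x) \<in> R} = {x. (x, x) \<in> R'}" "R - Id = R' - Id" by auto
    then show "R = R'" by auto
  qed
  ultimately have "card ?G \<le> card (SIGMA T:Pow S. ?F (S - T))"
    using S finF by (intro card_inj_on_le[of ?f]) auto
  also have "\<dots> = (\<Sum>T\<in>Pow S. card (?F (S - T)))"
    using S finF by (intro card_SigmaI) auto
  finally have "real (card ?G) \<le> real (\<Sum>T\<in>Pow S. card (?F (S - T)))"
    by (simp only: of_nat_le_iff)
  also have "\<dots> = (\<Sum>T\<in>Pow S. real (card (?F (S - T))))"
    by (rule of_nat_sum)
  also have "\<dots> \<le> (\<Sum>T\<in>Pow S. fact (?n - card T) * forest_coeff ?n)"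
  proof (rule sum_mono)
    fix T assume T: "T \<in> Pow S"
    then have c: "card (S - T) = ?n - card T" using S by (auto intro: card_Diff_subset finite_subset)
    have "real (card (?F (S - T))) \<le> fact (?n - card T) * forest_coeff (?n - card T)"
      using card_acyclic[of "S - T"] S c by simp
    also have "\<dots> \<le> fact (?n - card T) * forest_coeff ?n"
      by (intro mult_left_mono forest_coeff_mono) auto
    finally show "real (card (?F (S - T))) \<le> fact (?n - card T) * forest_coeff ?n" .
  qed
  also have "\<dots> = (\<Sum>j\<le>?n. real (?n choose j) * (fact (?n - j) * forest_coeff ?n))"
    by (rule sum_Pow_card[OF S])
  also have "\<dots> = (\<Sum>j\<le>?n. 1 ^ j / fact j) * (fact ?n * forest_coeff ?n)"
    unfolding sum_distrib_right
    by (intro sum.cong) (auto simp: binomial_fact)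
  also have "\<dots> \<le> exp 1 * (fact ?n * forest_coeff ?n)"
    by (intro mult_right_mono sum_power_fact_le_exp) (auto simp: forest_coeff_def sum_nonneg)
  also have "\<dots> \<le> exp 1 * (fact ?n * (injection_coeff ?n / sqrt ?n))"
  proof -
    have "real ?n * forest_coeff ?n \<le> sqrt ?n * injection_coeff ?n"
      using deficit_first_moment[of ?n] forest_coeff_eq_mean_deficit[of ?n] by simp
    also have "sqrt ?n * injection_coeff ?n = real ?n * (injection_coeff ?n / sqrt ?n)"
      using n by (simp add: field_simps real_sqrt_mult_self)
    finally have "forest_coeff ?n \<le> injection_coeff ?n / sqrt ?n"
      using n by (simp only: mult_le_cancel_left_pos of_nat_0_less_iff)
    then show ?thesis by (intro mult_left_mono) auto
  qed
  also have "\<dots> = exp 1 / sqrt ?n * real (card (partial_injections S))"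
    using card_partial_injections[OF S] by simp
  finally show ?thesis .
qed

section \<open>Pairs of partial injections with a leaf\<close>

text \<open>The predicate \<open>P v R\<close> stands for membership of \<open>v\<close> in the domain, or in the range, of \<open>R\<close>. Summing over all
vertices turns the probabilities of missing \<open>v\<close> into the expected number of missing points.\<close>

lemma sum_card_missing:
  assumes S: "finite S"
    and D: "\<And>R. R \<in> partial_injections S \<Longrightarrow> card {v \<in> S. \<not> P v R} = card S - card R"
  shows "(\<Sum>v\<in>S. real (card {R \<in> partial_injections S. \<not> P v R}))
    \<le> sqrt (card S) * card (partial_injections S)"
proof -
  let ?n = "card S" and ?I = "partial_injections S"
  have "(\<Sum>v\<in>S. real (card {R \<in> ?I. \<not> P v R})) = (\<Sum>v\<in>S. \<Sum>R | R \<in> ?I \<and> \<not> P v R. 1)"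
    by simp
  also have "\<dots> = (\<Sum>R\<in>?I. \<Sum>v | v \<in> S \<and> \<not> P v R. 1)"
    using S finite_partial_injections[OF S] by (rule sum.swap_restrict)
  also have "\<dots> = (\<Sum>R\<in>?I. real (?n - card R))"
    using D by (intro sum.cong) auto
  also have "\<dots> = fact ?n * (\<Sum>k\<le>?n. real k * deficit_weight ?n k)"
    by (rule sum_partial_injections[OF S])
  also have "\<dots> \<le> fact ?n * (sqrt ?n * injection_coeff ?n)"
    by (intro mult_left_mono deficit_first_moment) auto
  finally show ?thesis using card_partial_injections[OF S] by (simp add: mult_ac)
qed

definition missing :: "'v \<Rightarrow> ('v \<times> 'v) set \<Rightarrow> bool" where
  "missing v R \<longleftrightarrow> v \<notin> Domain R \<or> v \<notin> Range R"

definition isolated :: "'v \<Rightarrow> ('v \<times> 'v) set \<Rightarrow> bool" where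
  "isolated v R \<longleftrightarrow> v \<notin> Domain R \<and> v \<notin> Range R"

lemma sum_missing:
  assumes S: "finite S"
  shows "(\<Sum>v\<in>S. real (card {R \<in> partial_injections S. missing v R}))
    \<le> 2 * (sqrt (card S) * card (partial_injections S))"
proof -
  let ?I = "partial_injections S"
  have "real (card {R \<in> ?I. missing v R}) \<le>
      real (card {R \<in> ?I. v \<notin> Domain R}) + real (card {R \<in> ?I. v \<notin> Range R})" for v
  proof -
    have "{R \<in> ?I. missing v R} = {R \<in> ?I. v \<notin> Domain R} \<union> {R \<in> ?I. v \<notin> Range R}"
      by (auto simp: missing_def)
    then have "card {R \<in> ?I. missing v R} \<le>
        card {R \<in> ?I. v \<notin> Domain R} + card {R \<in> ?I. v \<notin> Range R}"
      by (simp only: card_Un_le)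
    then show ?thesis by linarith
  qed
  then have "(\<Sum>v\<in>S. real (card {R \<in> ?I. missing v R})) \<le>
      (\<Sum>v\<in>S. real (card {R \<in> ?I. v \<notin> Domain R}) + real (card {R \<in> ?I. v \<notin> Range R}))"
    by (intro sum_mono)
  also have "\<dots> \<le> sqrt (card S) * card ?I + sqrt (card S) * card ?I"
    unfolding sum.distrib
    using card_missing[OF S] by (intro add_mono sum_card_missing[OF S]) (simp_all add: set_diff_eq)
  finally show ?thesis by (simp only: mult_2)
qed

text \<open>Deleting an isolated point leaves an arbitrary partial injection of the remaining points.\<close>

lemma card_isolated:
  assumes S: "finite S" and v: "v \<in> S"
  shows "real (card {R \<in> partial_injections S. isolated v R})
    \<le> card (partial_injections S) / card S"
proof -
  have eq: "{R \<in> partial_injections S. isolated v R} = partial_injections (S - {v})"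
    by (auto simp: partial_injections_def isolated_def)
  obtain n where n: "card S = Suc n" using S v by (metis card_Suc_Diff1)
  then have n': "card (S - {v}) = n" using S v by simp
  have "real (card {R \<in> partial_injections S. isolated v R}) = fact n * injection_coeff n"
    unfolding eq using card_partial_injections[of "S - {v}"] S n' by simp
  also have "\<dots> \<le> fact n * injection_coeff (Suc n)"
    by (intro mult_left_mono injection_coeff_mono) auto
  also have "\<dots> = card (partial_injections S) / card S"
    using card_partial_injections[OF S] unfolding n by (simp add: field_simps)
  finally show ?thesis .
qed

text \<open>A vertex that occurs at most once in a graph has at least three of its four slots empty for any two
letters.\<close>

definition leaf_pairs :: "'v set \<Rightarrow> (('v \<times> 'v) set \<times> ('v \<times> 'v) set) set" where
  "leaf_pairs S = {(R, R') \<in> partial_injections S \<times> partial_injections S.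
    \<exists>v\<in>S. isolated v R \<and> missing v R' \<or> missing v R \<and> isolated v R'}"

text \<open>Being isolated costs a factor \<open>1 / n\<close> for every vertex, and the probabilities that a vertex is
missing add up to at most \<open>2 sqrt n\<close>.\<close>

lemma card_leaf_pairs:
  assumes S: "finite S" "card S > 0"
  shows "real (card (leaf_pairs S)) \<le> 4 / sqrt (card S) * (card (partial_injections S))\<^sup>2"
proof -
  let ?I = "partial_injections S"
  let ?N = "real (card ?I)" and ?n = "real (card S)"
  let ?i = "\<lambda>v. {R \<in> ?I. isolated v R}" and ?m = "\<lambda>v. {R \<in> ?I. missing v R}"
  have fin: "finite (?i v)" "finite (?m v)" for v using finite_partial_injections[OF S(1)] by auto
  have "leaf_pairs S \<subseteq> (\<Union>v\<in>S. ?i v \<times> ?m v \<union> ?m v \<times> ?i v)"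
    by (auto simp: leaf_pairs_def)
  then have "card (leaf_pairs S) \<le> card (\<Union>v\<in>S. ?i v \<times> ?m v \<union> ?m v \<times> ?i v)"
    using S fin by (intro card_mono) auto
  also have "\<dots> \<le> (\<Sum>v\<in>S. card (?i v \<times> ?m v \<union> ?m v \<times> ?i v))"
    using S by (intro card_UN_le)
  also have "\<dots> \<le> (\<Sum>v\<in>S. 2 * (card (?i v) * card (?m v)))"
  proof (rule sum_mono)
    fix v
    show "card (?i v \<times> ?m v \<union> ?m v \<times> ?i v) \<le> 2 * (card (?i v) * card (?m v))"
      using card_Un_le[of "?i v \<times> ?m v" "?m v \<times> ?i v"]
      by (simp add: card_cartesian_product mult.commute)
  qed
  finally have "real (card (leaf_pairs S)) \<le> (\<Sum>v\<in>S. 2 * (real (card (?i v)) * real (card (?m v))))"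
    by (metis (mono_tags, lifting) of_nat_le_iff of_nat_mult of_nat_numeral of_nat_sum sum.cong)
  also have "\<dots> \<le> (\<Sum>v\<in>S. 2 * (?N / ?n * real (card (?m v))))"
    using card_isolated[OF S(1)] by (intro sum_mono mult_left_mono mult_right_mono) auto
  also have "\<dots> = 2 * ?N / ?n * (\<Sum>v\<in>S. real (card (?m v)))"
    unfolding sum_distrib_left by (intro sum.cong) auto
  also have "\<dots> \<le> 2 * ?N / ?n * (2 * (sqrt ?n * ?N))"
    using sum_missing[OF S(1)] by (intro mult_left_mono) auto
  also have "\<dots> = 4 * (sqrt ?n / ?n) * ?N\<^sup>2"
    by (simp add: power2_eq_square)
  also have "sqrt ?n / ?n = 1 / sqrt ?n"
    by (metis real_div_sqrt inverse_eq_divide inverse_divide of_nat_0_le_iff)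
  finally show ?thesis by simp
qed

section \<open>Pairs of partial injections that respect a small set\<close>

definition splits :: "'v set \<Rightarrow> 'v set \<Rightarrow> ('v \<times> 'v) set \<Rightarrow> bool" where
  "splits S U R \<longleftrightarrow> R \<subseteq> U \<times> U \<union> (S - U) \<times> (S - U)"

text \<open>A partial injection that respects \<open>U\<close> is a pair of partial injections, of \<open>U\<close> and of its complement.
The binomial coefficient comes from the factorials in the two counts.\<close>

lemma card_splits:
  assumes S: "finite S" and U: "U \<subseteq> S"
  shows "real (card {R \<in> partial_injections S. splits S U R})
    \<le> card (partial_injections S) * (injection_coeff (card U) / real (card S choose card U))"
proof -
  let ?X = "{R \<in> partial_injections S. splits S U R}" and ?n = "card S" and ?k = "card U"
  let ?f = "\<lambda>R. (R \<inter> U \<times> U, R \<inter> (S - U) \<times> (S - U))"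
  have fU: "finite U" using U S finite_subset by blast
  have k: "?k \<le> ?n" using card_mono[OF S U] .
  have c: "card (S - U) = ?n - ?k" using card_Diff_subset[OF fU U] .
  have "?f ` ?X \<subseteq> partial_injections U \<times> partial_injections (S - U)"
    unfolding partial_injections_def
    by (auto intro: single_valued_subset[rotated])
  moreover have "inj_on ?f ?X"
  proof (rule inj_onI)
    fix R R' assume "R \<in> ?X" "R' \<in> ?X" "?f R = ?f R'"
    then have "R = (R \<inter> U \<times> U) \<union> (R \<inter> (S - U) \<times> (S - U))"
      "R' = (R \<inter> U \<times> U) \<union> (R \<inter> (S - U) \<times> (S - U))"
      unfolding splits_def by blast+
    then show "R = R'" by metis
  qed
  ultimately have "card ?X \<le> card (partial_injections U \<times> partial_injections (S - U))"
    using finite_partial_injections[OF fU] finite_partial_injections[of "S - U"] S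
    by (intro card_inj_on_le[of ?f]) auto
  then have "real (card ?X) \<le> real (card (partial_injections U)) * real (card (partial_injections (S - U)))"
    by (metis card_cartesian_product of_nat_le_iff of_nat_mult)
  also have "\<dots> = (fact ?k * injection_coeff ?k) * (fact (?n - ?k) * injection_coeff (?n - ?k))"
    using card_partial_injections[OF fU] card_partial_injections[of "S - U"] S c by simp
  also have "\<dots> \<le> (fact ?k * injection_coeff ?k) * (fact (?n - ?k) * injection_coeff ?n)"
    using injection_coeff_ge_1[of ?k] by (intro mult_left_mono injection_coeff_mono) auto
  also have "\<dots> = card (partial_injections S) * (injection_coeff ?k / real (?n choose ?k))"
    using card_partial_injections[OF S] binomial_fact[OF k, where 'a = real] by simp
  finally show ?thesis .
qed

text \<open>For every \<open>t > 0\<close> one has \<open>1 / j! \<le> exp t / t\<^sup>j\<close>, which bounds the sum by \<open>exp t (1 + 1/t)\<^sup>k\<close>. The value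
\<open>t = 4\<close> makes the square of the base, \<open>25/16\<close>, smaller than \<open>2\<close>; this beats the binomial coefficients, which
are at least of order \<open>2\<^sup>k\<close> for \<open>k\<close> up to \<open>n / 2\<close>.\<close>

lemma injection_coeff_le_exp: "injection_coeff k \<le> exp 4 * (5/4) ^ k"
proof -
  have "injection_coeff k \<le> (\<Sum>j\<le>k. exp 4 * (real (k choose j) * (1/4) ^ j * 1 ^ (k - j)))"
    unfolding injection_coeff_def
  proof (rule sum_mono)
    fix j
    have "4 ^ j / fact j \<le> (\<Sum>i\<le>j. (4::real) ^ i / fact i)"
      by (rule member_le_sum) auto
    also have "\<dots> \<le> exp 4" by (rule sum_power_fact_le_exp) simp
    finally have "1 / fact j \<le> exp 4 * (1/4 :: real) ^ j"
      by (simp add: field_simps power_divide)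
    then have "real (k choose j) * (1 / fact j) \<le> real (k choose j) * (exp 4 * (1/4) ^ j)"
      by (intro mult_left_mono) auto
    then show "deficit_weight k j \<le> exp 4 * (real (k choose j) * (1/4) ^ j * 1 ^ (k - j))"
      by (simp add: deficit_weight_def mult_ac)
  qed
  also have "\<dots> = exp 4 * (1/4 + 1) ^ k"
    unfolding sum_distrib_left[symmetric] binomial_ring by simp
  finally show ?thesis by simp
qed

lemma binomial_lower:
  assumes k: "1 \<le> k" "2 * k \<le> n"
  shows "real n / real k * 2 ^ (k - 1) \<le> real (n choose k)"
proof -
  have "2 ^ (k - 1) \<le> (real (n - 1) / real (k - 1)) ^ (k - 1)"
  proof (cases "k = 1")
    case False
    with k have "2 \<le> real (n - 1) / real (k - 1)" by (simp add: field_simps of_nat_diff)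
    then show ?thesis by (intro power_mono) auto
  qed simp
  also have "\<dots> \<le> real ((n - 1) choose (k - 1))"
    using k binomial_ge_n_over_k_pow_k[of "k - 1" "n - 1", where 'a = real] by simp
  finally have "real n * 2 ^ (k - 1) \<le> real n * real ((n - 1) choose (k - 1))"
    by (intro mult_left_mono) auto
  also have "\<dots> = real k * real (n choose k)"
    using times_binomial_minus1_eq[of k n] k by (metis of_nat_mult less_eq_Suc_le One_nat_def)
  finally show ?thesis using k by (simp add: field_simps)
qed

text \<open>Of a set respected by both relations and its complement, one has at most half of the points.\<close>

definition split_pairs :: "'v set \<Rightarrow> (('v \<times> 'v) set \<times> ('v \<times> 'v) set) set" where
  "split_pairs S = {(R, R') \<in> partial_injections S \<times> partial_injections S.
    \<exists>U\<subseteq>S. U \<noteq> {} \<and> 2 * card U \<le> card S \<and> splits S U R \<and> splits S U R'}"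

text \<open>The left-hand side bounds the expected number of sets with \<open>k\<close> elements that are respected by two
independent random partial injections. The extra factor \<open>n / k\<close> in \<open>binomial_lower\<close> provides the decay in \<open>n\<close>.\<close>

lemma split_pairs_summand:
  assumes k: "1 \<le> k" "2 * k \<le> n"
  shows "real (n choose k) * (injection_coeff k / real (n choose k))\<^sup>2
    \<le> 2 * exp 8 / real n * (real (Suc k) * (25/32) ^ k)"
proof -
  have n: "n > 0" using k by simp
  have C: "real (n choose k) > 0" using k by (simp add: zero_less_binomial)
  have L: "real n / real k * 2 ^ (k - 1) > 0" using k n by simp
  have "real (n choose k) * (injection_coeff k / real (n choose k))\<^sup>2 = (injection_coeff k)\<^sup>2 / real (n choose k)"
    using C by (simp add: power2_eq_square)
  also have "\<dots> \<le> (exp 4 * (5/4) ^ k)\<^sup>2 / (real n / real k * 2 ^ (k - 1))"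
    using binomial_lower[OF k] injection_coeff_le_exp[of k] injection_coeff_ge_1[of k] L C
    by (intro frac_le power_mono) auto
  also have "(exp 4 * (5/4) ^ k)\<^sup>2 = exp 8 * ((25/16) ^ k :: real)"
  proof -
    have "((5/4) ^ k)\<^sup>2 = ((25/16) ^ k :: real)"
      by (simp add: power2_eq_square flip: power_mult_distrib)
    moreover have "(exp 4)\<^sup>2 = (exp 8 :: real)"
      by (simp add: power2_eq_square flip: exp_add)
    ultimately show ?thesis by (simp only: power_mult_distrib)
  qed
  also have "exp 8 * (25/16) ^ k / (real n / real k * 2 ^ (k - 1)) =
      2 * exp 8 / real n * (real k * (25/32) ^ k)"
  proof -
    define q :: real where "q = (25/32) ^ k"
    define t :: real where "t = 2 ^ (k - 1)"
    have "2 ^ k = 2 * t" using k unfolding t_def by (cases k) auto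
    moreover have "(25/16) ^ k = q * 2 ^ k" unfolding q_def by (simp flip: power_mult_distrib)
    ultimately have "(25/16) ^ k = q * (2 * t)" by simp
    moreover have "t > 0" by (simp add: t_def)
    ultimately show ?thesis
      unfolding q_def[symmetric] t_def[symmetric] using k n by (simp add: field_simps)
  qed
  also have "\<dots> \<le> 2 * exp 8 / real n * (real (Suc k) * (25/32) ^ k)"
    by (intro mult_left_mono mult_right_mono) auto
  finally show ?thesis .
qed

text \<open>The constant \<open>1024/49\<close> is the sum \<open>1 / (1 - 25/32)\<^sup>2\<close> of the series \<open>(k + 1) (25/32)\<^sup>k\<close>.\<close>

lemma card_split_pairs:
  assumes S: "finite S"
  shows "real (card (split_pairs S)) \<le>
    2 * exp 8 * (1024/49) / real (card S) * (card (partial_injections S))\<^sup>2"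
proof -
  let ?I = "partial_injections S"
  let ?N = "real (card ?I)" and ?n = "card S"
  let ?s = "\<lambda>U. {R \<in> ?I. splits S U R}"
  define g where "g = (\<lambda>k. if 1 \<le> k \<and> 2 * k \<le> ?n then (?N * (injection_coeff k / real (?n choose k)))\<^sup>2 else 0)"
  let ?P = "{U \<in> Pow S. U \<noteq> {} \<and> 2 * card U \<le> ?n}"
  have fin: "finite (?s U)" for U using finite_partial_injections[OF S] by simp
  have "split_pairs S \<subseteq> (\<Union>U\<in>?P. ?s U \<times> ?s U)"
    by (auto simp: split_pairs_def)
  then have "card (split_pairs S) \<le> card (\<Union>U\<in>?P. ?s U \<times> ?s U)"
    using S fin by (intro card_mono) auto
  also have "\<dots> \<le> (\<Sum>U\<in>?P. card (?s U \<times> ?s U))"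
    using S by (intro card_UN_le) auto
  finally have "real (card (split_pairs S)) \<le> real (\<Sum>U\<in>?P. card (?s U \<times> ?s U))"
    by (simp only: of_nat_le_iff)
  also have "\<dots> = (\<Sum>U\<in>?P. (real (card (?s U)))\<^sup>2)"
    by (simp add: card_cartesian_product power2_eq_square)
  also have "\<dots> \<le> (\<Sum>U\<in>?P. g (card U))"
  proof (rule sum_mono)
    fix U assume U: "U \<in> ?P"
    then have "card U > 0" using S by (auto simp: card_gt_0_iff intro: finite_subset)
    with U have g: "g (card U) = (?N * (injection_coeff (card U) / real (?n choose card U)))\<^sup>2"
      by (simp add: g_def Suc_le_eq)
    show "(real (card (?s U)))\<^sup>2 \<le> g (card U)"
      unfolding g using card_splits[OF S, of U] U by (intro power_mono) auto
  qed
  also have "\<dots> \<le> (\<Sum>U\<in>Pow S. g (card U))"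
    using S by (intro sum_mono2) (auto simp: g_def)
  also have "\<dots> = (\<Sum>k\<le>?n. real (?n choose k) * g k)"
    by (rule sum_Pow_card[OF S])
  also have "\<dots> \<le> (\<Sum>k\<le>?n. ?N\<^sup>2 * (2 * exp 8 / real ?n) * (real (Suc k) * (25/32) ^ k))"
  proof (rule sum_mono)
    fix k
    show "real (?n choose k) * g k \<le> ?N\<^sup>2 * (2 * exp 8 / real ?n) * (real (Suc k) * (25/32) ^ k)"
    proof (cases "1 \<le> k \<and> 2 * k \<le> ?n")
      case True
      then have "?N\<^sup>2 * (real (?n choose k) * (injection_coeff k / real (?n choose k))\<^sup>2) \<le>
          ?N\<^sup>2 * (2 * exp 8 / real ?n * (real (Suc k) * (25/32) ^ k))"
        by (intro mult_left_mono split_pairs_summand) auto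
      moreover have "g k = (?N * (injection_coeff k / real (?n choose k)))\<^sup>2"
        unfolding g_def by (rule if_P[OF True])
      then have "real (?n choose k) * g k =
          ?N\<^sup>2 * (real (?n choose k) * (injection_coeff k / real (?n choose k))\<^sup>2)"
        by (simp only: power_mult_distrib mult_ac)
      ultimately show ?thesis by (simp only: mult.assoc)
    qed (auto simp: g_def)
  qed
  also have "\<dots> = ?N\<^sup>2 * (2 * exp 8 / real ?n) * (\<Sum>k\<le>?n. real (Suc k) * (25/32) ^ k)"
    by (simp only: sum_distrib_left)
  also have "\<dots> \<le> ?N\<^sup>2 * (2 * exp 8 / real ?n) * (1024/49)"
  proof (intro mult_left_mono)
    have *: "(\<lambda>k. real (Suc k) * (25/32) ^ k) sums (1 / (1 - 25/32)\<^sup>2)"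
      using geometric_deriv_sums[of "25/32 :: real"] by simp
    then have "(\<Sum>k\<in>{..?n}. real (Suc k) * (25/32) ^ k) \<le> (\<Sum>k. real (Suc k) * (25/32) ^ k)"
      by (intro sum_le_suminf) (auto simp: sums_iff)
    also have "\<dots> = 1024/49"
      using sums_unique[OF *] by (simp add: power2_eq_square)
    finally show "(\<Sum>k\<le>?n. real (Suc k) * (25/32) ^ k) \<le> 1024/49" .
  qed auto
  finally show ?thesis by (simp add: mult_ac)
qed

lemma card_bad_pairs:
  assumes S: "finite S" "card S > 0"
  shows "real (card (leaf_pairs S \<union> split_pairs S)) \<le>
    (4 + 2 * exp 8 * (1024/49)) / sqrt (card S) * (card (partial_injections S))\<^sup>2"
proof -
  let ?n = "real (card S)" and ?N = "real (card (partial_injections S))"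
  let ?K = "2 * exp 8 * (1024/49) :: real"
  \<comment> \<open>The term of order \<open>1 / n\<close> is absorbed into the one of order \<open>1 / sqrt n\<close>.\<close>
  have "sqrt ?n \<le> ?n" using S by (intro real_le_lsqrt self_le_power) (auto simp: Suc_le_eq)
  then have "?K / ?n \<le> ?K / sqrt ?n" using S by (intro divide_left_mono) auto
  then have *: "?K / ?n * ?N\<^sup>2 \<le> ?K / sqrt ?n * ?N\<^sup>2" by (intro mult_right_mono) auto
  have "real (card (leaf_pairs S \<union> split_pairs S)) \<le> real (card (leaf_pairs S)) + real (card (split_pairs S))"
    using card_Un_le[of "leaf_pairs S" "split_pairs S"] by linarith
  also have "\<dots> \<le> 4 / sqrt ?n * ?N\<^sup>2 + ?K / sqrt ?n * ?N\<^sup>2"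
    using card_leaf_pairs[OF S] card_split_pairs[OF S(1)] * unfolding of_nat_power by linarith
  finally show ?thesis by (simp add: add_divide_distrib distrib_right)
qed

section \<open>Graphs as families of partial injections\<close>

lemma letter_rel_partial_injection:
  "A_graph A V E \<Longrightarrow> letter_rel E a \<in> partial_injections V"
  unfolding A_graph_def letter_rel_def partial_injections_def
  by (auto intro!: single_valuedI)

lemma A_graph_eqI:
  assumes "A_graph A V E" "A_graph A V E'" "\<And>a. a \<in> A \<Longrightarrow> letter_rel E a = letter_rel E' a"
  shows "E = E'"
proof -
  have *: "(x, a, y) \<in> E \<longleftrightarrow> (x, a, y) \<in> E'" for x a y
  proof (cases "a \<in> A")
    case True
    then have "(x, y) \<in> letter_rel E a \<longleftrightarrow> (x, y) \<in> letter_rel E' a" using assms(3) by simp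
    then show ?thesis by (simp add: letter_rel_def)
  next
    case False
    then show ?thesis using assms(1,2) by (auto simp: A_graph_def)
  qed
  show ?thesis
  proof (rule Set.set_eqI)
    fix e show "e \<in> E \<longleftrightarrow> e \<in> E'" using * by (cases e) simp
  qed
qed

lemma inj_on_letter_rel:
  "inj_on (\<lambda>E. \<lambda>a\<in>A. letter_rel E a) {E. A_graph A V E}"
proof (rule inj_onI)
  fix E E' assume E: "E \<in> {E. A_graph A V E}" "E' \<in> {E. A_graph A V E}"
    and eq: "(\<lambda>a\<in>A. letter_rel E a) = (\<lambda>a\<in>A. letter_rel E' a)"
  show "E = E'"
  proof (rule A_graph_eqI)
    fix a assume "a \<in> A"
    then show "letter_rel E a = letter_rel E' a" using fun_cong[OF eq, of a] by simp
  qed (use E in auto)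
qed

lemma bij_betw_letter_rel:
  "bij_betw (\<lambda>E. \<lambda>a\<in>A. letter_rel E a) {E. A_graph A V E} (\<Pi>\<^sub>E a\<in>A. partial_injections V)"
  unfolding bij_betw_def
proof (intro conjI inj_on_letter_rel subset_antisym subsetI)
  fix g assume "g \<in> (\<lambda>E. \<lambda>a\<in>A. letter_rel E a) ` {E. A_graph A V E}"
  then show "g \<in> (\<Pi>\<^sub>E a\<in>A. partial_injections V)"
    using letter_rel_partial_injection by fastforce
next
  fix g assume g: "g \<in> (\<Pi>\<^sub>E a\<in>A. partial_injections V)"
  define E where "E = {(x, a, y). a \<in> A \<and> (x, y) \<in> g a}"
  have ga: "g a \<in> partial_injections V" if "a \<in> A" for a using g that by auto
  have "A_graph A V E"
    unfolding A_graph_def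
  proof (intro conjI allI impI subsetI)
    fix e assume "e \<in> E"
    then show "e \<in> V \<times> A \<times> V" using ga by (fastforce simp: E_def partial_injections_def)
  next
    fix u a v v' assume "(u, a, v) \<in> E" "(u, a, v') \<in> E"
    then show "v = v'" using ga[of a] by (auto simp: E_def partial_injections_def dest: single_valuedD)
  next
    fix u u' a v assume "(u, a, v) \<in> E" "(u', a, v) \<in> E"
    then show "u = u'" using ga[of a] by (auto simp: E_def partial_injections_def dest: single_valuedD)
  qed
  moreover have "g = (\<lambda>a\<in>A. letter_rel E a)"
  proof (rule ext)
    fix a show "g a = (\<lambda>a\<in>A. letter_rel E a) a"
      using g by (cases "a \<in> A") (auto simp: E_def letter_rel_def PiE_def extensional_def)
  qed
  ultimately show "g \<in> (\<lambda>E. \<lambda>a\<in>A. letter_rel E a) ` {E. A_graph A V E}" by blast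
qed

lemma card_A_graphs:
  "finite A \<Longrightarrow> card {E. A_graph A V E} = card (partial_injections V) ^ card A"
  using bij_betw_same_card[OF bij_betw_letter_rel, of A V] by (simp add: card_PiE)

lemma finite_A_graphs: "finite A \<Longrightarrow> finite V \<Longrightarrow> finite {E. A_graph A V E}"
  by (rule finite_subset[of _ "Pow (V \<times> A \<times> V)"]) (auto simp: A_graph_def)

lemma card_A_graphs_letterwise:
  assumes A: "finite A" and X: "finite X"
  shows "card {E. A_graph A V E \<and> (\<forall>a\<in>A. letter_rel E a \<in> X)} \<le> card X ^ card A"
proof -
  let ?G = "{E. A_graph A V E \<and> (\<forall>a\<in>A. letter_rel E a \<in> X)}"
  have "card ?G \<le> card (\<Pi>\<^sub>E a\<in>A. X)"
  proof (rule card_inj_on_le)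
    show "inj_on (\<lambda>E. \<lambda>a\<in>A. letter_rel E a) ?G"
      by (rule inj_on_subset[OF inj_on_letter_rel]) auto
    show "(\<lambda>E. \<lambda>a\<in>A. letter_rel E a) ` ?G \<subseteq> (\<Pi>\<^sub>E a\<in>A. X)" by auto
    show "finite (\<Pi>\<^sub>E a\<in>A. X)" using A X by (simp add: finite_PiE)
  qed
  then show ?thesis using A by (simp add: card_PiE)
qed

lemma card_A_graphs_two_letters:
  assumes A: "finite A" and V: "finite V" and ab: "a \<in> A" "b \<in> A" "a \<noteq> b"
    and B: "B \<subseteq> partial_injections V \<times> partial_injections V"
  shows "card {E. A_graph A V E \<and> (letter_rel E a, letter_rel E b) \<in> B}
    \<le> card B * card (partial_injections V) ^ (card A - 2)"
proof -
  let ?G = "{E. A_graph A V E \<and> (letter_rel E a, letter_rel E b) \<in> B}"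
  let ?A = "A - {a, b}" and ?I = "partial_injections V"
  let ?f = "\<lambda>E. ((letter_rel E a, letter_rel E b), \<lambda>c\<in>?A. letter_rel E c)"
  have finI: "finite ?I" using finite_partial_injections[OF V] .
  have finB: "finite B" using finite_subset[OF B] finI by simp
  have "card ?G \<le> card (B \<times> (\<Pi>\<^sub>E c\<in>?A. ?I))"
  proof (rule card_inj_on_le[of ?f])
    show "inj_on ?f ?G"
    proof (rule inj_onI)
      fix E E' assume E: "E \<in> ?G" "E' \<in> ?G" and eq: "?f E = ?f E'"
      show "E = E'"
      proof (rule A_graph_eqI)
        fix c assume c: "c \<in> A"
        have "(\<lambda>c\<in>?A. letter_rel E c) c = (\<lambda>c\<in>?A. letter_rel E' c) c" using eq by simp
        then show "letter_rel E c = letter_rel E' c"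
          using eq c by (cases "c \<in> {a, b}") auto
      qed (use E in auto)
    qed
    show "?f ` ?G \<subseteq> B \<times> (\<Pi>\<^sub>E c\<in>?A. ?I)"
    proof (rule image_subsetI)
      fix E assume E: "E \<in> ?G"
      then have "A_graph A V E" by simp
      from letter_rel_partial_injection[OF this] have "letter_rel E c \<in> ?I" for c .
      then have "(\<lambda>c\<in>?A. letter_rel E c) \<in> (\<Pi>\<^sub>E c\<in>?A. ?I)"
        by (simp add: restrict_PiE_iff)
      with E show "?f E \<in> B \<times> (\<Pi>\<^sub>E c\<in>?A. ?I)" by simp
    qed
    show "finite (B \<times> (\<Pi>\<^sub>E c\<in>?A. ?I))" using A finI finB by (intro finite_SigmaI finite_PiE) auto
  qed
  moreover have "card ?A = card A - 2" using A ab by (simp add: card_Diff_subset)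
  ultimately show ?thesis using A by (simp add: card_cartesian_product card_PiE)
qed

section \<open>Most families are admissible\<close>

text \<open>The edges at \<open>v\<close> carrying the letters \<open>a\<close> and \<open>b\<close> occupy four slots, outgoing and incoming for each
letter, and at a leaf only one of them can be filled.\<close>

lemma leaf_missing:
  assumes E: "A_graph A V E" and A: "finite A" "finite V" and ab: "a \<noteq> b" and leaf: "leaf E v"
  shows "isolated v (letter_rel E a) \<and> missing v (letter_rel E b) \<or>
    missing v (letter_rel E a) \<and> isolated v (letter_rel E b)"
proof -
  have "finite E"
    by (rule finite_subset[of _ "V \<times> A \<times> V"]) (use E A in \<open>auto simp: A_graph_def\<close>)
  then have fin: "finite {(x, a, y) \<in> E. x = v}" "finite {(x, a, y) \<in> E. y = v}"
    by (auto intro: finite_subset[of _ E])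
  have "{c \<in> {a, b}. v \<in> Domain (letter_rel E c)} \<subseteq> (fst \<circ> snd) ` {(x, a, y) \<in> E. x = v}"
    by (force simp: letter_rel_def)
  then have out: "card {c \<in> {a, b}. v \<in> Domain (letter_rel E c)} \<le> card {(x, a, y) \<in> E. x = v}"
    by (rule surj_card_le[OF fin(1)])
  have "{c \<in> {a, b}. v \<in> Range (letter_rel E c)} \<subseteq> (fst \<circ> snd) ` {(x, a, y) \<in> E. y = v}"
    by (force simp: letter_rel_def)
  then have "card {c \<in> {a, b}. v \<in> Range (letter_rel E c)} \<le> card {(x, a, y) \<in> E. y = v}"
    by (rule surj_card_le[OF fin(2)])
  with out leaf have le: "card {c \<in> {a, b}. v \<in> Domain (letter_rel E c)} +
      card {c \<in> {a, b}. v \<in> Range (letter_rel E c)} \<le> 1"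
    unfolding leaf_def by linarith
  have c: "card {c \<in> {a, b}. P c} = of_bool (P a) + of_bool (P b)" for P
  proof -
    have "{c \<in> {a, b}. P c} = (if P a then {a} else {}) \<union> (if P b then {b} else {})" by auto
    then show ?thesis using ab by (simp add: card_insert_if)
  qed
  show ?thesis
    using le unfolding c isolated_def missing_def
    by (cases "v \<in> Domain (letter_rel E a)"; cases "v \<in> Domain (letter_rel E b)";
        cases "v \<in> Range (letter_rel E a)"; cases "v \<in> Range (letter_rel E b)") simp_all
qed

text \<open>The component of a vertex and its complement are both respected by every letter; the smaller of the
two serves.\<close>

lemma disconnected_splits:
  assumes E: "A_graph A V E" and V: "finite V" and disc: "\<not> connected_graph V E"
  shows "\<exists>U\<subseteq>V. U \<noteq> {} \<and> 2 * card U \<le> card V \<and> (\<forall>a. splits V U (letter_rel E a))"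
proof -
  let ?r = "{(x, y). \<exists>a. (x, a, y) \<in> E \<or> (y, a, x) \<in> E}"
  obtain u v where uv: "u \<in> V" "v \<in> V" "(u, v) \<notin> ?r\<^sup>*"
    using disc by (auto simp: connected_graph_def)
  define W where "W = {w \<in> V. (u, w) \<in> ?r\<^sup>*}"
  have W: "W \<subseteq> V" "u \<in> W" "v \<in> V - W" using uv by (auto simp: W_def)
  have closed: "x \<in> W \<longleftrightarrow> y \<in> W" if "(x, a, y) \<in> E" for x a y
  proof -
    have "x \<in> V" "y \<in> V" using that E by (auto simp: A_graph_def)
    moreover have "(x, y) \<in> ?r" "(y, x) \<in> ?r" using that by auto
    ultimately show ?thesis unfolding W_def by (auto intro: rtrancl_into_rtrancl)
  qed
  have sp: "splits V U (letter_rel E a)" if "U = W \<or> U = V - W" for U a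
    unfolding splits_def
  proof (rule subrelI)
    fix x y assume "(x, y) \<in> letter_rel E a"
    then have e: "(x, a, y) \<in> E" by (simp add: letter_rel_def)
    then have "x \<in> V" "y \<in> V" using E by (auto simp: A_graph_def)
    then show "(x, y) \<in> U \<times> U \<union> (V - U) \<times> (V - U)" using closed[OF e] that by auto
  qed
  have "card W + card (V - W) = card V"
    using card_Diff_subset[of W V] card_mono[OF V W(1)] finite_subset[OF W(1) V] W(1) by simp
  then have "2 * card W \<le> card V \<or> 2 * card (V - W) \<le> card V" by linarith
  then show ?thesis
  proof
    assume "2 * card W \<le> card V"
    then show ?thesis using W sp by (intro exI[of _ W]) auto
  next
    assume "2 * card (V - W) \<le> card V"
    then show ?thesis using W sp by (intro exI[of _ "V - W"]) auto
  qed
qed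

lemma not_admissible_bad_pairs:
  assumes E: "A_graph A V E" and A: "finite A" "finite V" and p: "p \<in> V" and ab: "a \<noteq> b"
    and na: "\<not> admissible A V E p"
  shows "(letter_rel E a, letter_rel E b) \<in> leaf_pairs V \<union> split_pairs V"
proof (cases "connected_graph V E")
  case True
  then obtain v where "v \<in> V" "leaf E v" using na E A p by (auto simp: admissible_def)
  moreover have "letter_rel E c \<in> partial_injections V" for c
    by (rule letter_rel_partial_injection[OF E])
  ultimately have "(letter_rel E a, letter_rel E b) \<in> leaf_pairs V"
    using leaf_missing[OF E A ab, of v] unfolding leaf_pairs_def by blast
  then show ?thesis ..
next
  case False
  from disconnected_splits[OF E A(2) this] obtain U where U: "U \<subseteq> V" "U \<noteq> {}"
    "2 * card U \<le> card V" "\<And>c. splits V U (letter_rel E c)" by blast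
  have "letter_rel E c \<in> partial_injections V" for c by (rule letter_rel_partial_injection[OF E])
  with U have "(letter_rel E a, letter_rel E b) \<in> split_pairs V"
    unfolding split_pairs_def by blast
  then show ?thesis ..
qed

definition bad_pair_const :: real where
  "bad_pair_const = 4 + 2 * exp 8 * (1024/49)"

text \<open>The bad pairs occupy at most half of all pairs for two fixed letters, and the other letters are
arbitrary.\<close>

lemma card_labelled_lower:
  assumes A: "finite A" "card A \<ge> 2" and n: "n > 0" and large: "bad_pair_const / sqrt n \<le> 1 / 2"
  shows "real (card (partial_injections {..<n})) ^ card A / 2 \<le> real (card (labelled_graphs A n))"
proof -
  let ?V = "{..<n}" and ?r = "card A"
  let ?N = "card (partial_injections ?V)" and ?B = "leaf_pairs ?V \<union> split_pairs ?V"
  obtain a b where ab: "a \<in> A" "b \<in> A" "a \<noteq> b"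
    using A by (metis card_le_Suc0_iff_eq not_less_eq_eq numeral_2_eq_2)
  have B: "?B \<subseteq> partial_injections ?V \<times> partial_injections ?V"
    by (auto simp: leaf_pairs_def split_pairs_def)
  let ?G = "{E. A_graph A ?V E \<and> (letter_rel E a, letter_rel E b) \<in> ?B}"
  have "{E. A_graph A ?V E} \<subseteq> labelled_graphs A n \<union> ?G"
    using not_admissible_bad_pairs[OF _ A(1) _ _ ab(3), of ?V _ 0] n by (auto simp: labelled_graphs_def)
  then have "card {E. A_graph A ?V E} \<le> card (labelled_graphs A n \<union> ?G)"
    using finite_labelled_graphs[OF A(1)] finite_A_graphs[OF A(1), of ?V] by (intro card_mono) auto
  also have "\<dots> \<le> card (labelled_graphs A n) + card ?G" by (rule card_Un_le)
  also have "\<dots> \<le> card (labelled_graphs A n) + card ?B * ?N ^ (?r - 2)"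
    using card_A_graphs_two_letters[OF A(1) _ ab B] by simp
  finally have "?N ^ ?r \<le> card (labelled_graphs A n) + card ?B * ?N ^ (?r - 2)"
    using card_A_graphs[OF A(1), of ?V] by simp
  then have "real (?N ^ ?r) \<le> real (card (labelled_graphs A n) + card ?B * ?N ^ (?r - 2))"
    by (simp only: of_nat_le_iff)
  then have "real ?N ^ ?r \<le> card (labelled_graphs A n) + real (card ?B) * real ?N ^ (?r - 2)" by simp
  also have "real (card ?B) * real ?N ^ (?r - 2) \<le> (1 / 2 * (real ?N)\<^sup>2) * real ?N ^ (?r - 2)"
  proof (rule mult_right_mono)
    have "real (card ?B) \<le> bad_pair_const / sqrt n * (real ?N)\<^sup>2"
      using card_bad_pairs[of ?V] n unfolding bad_pair_const_def by simp
    also have "\<dots> \<le> 1 / 2 * (real ?N)\<^sup>2" using large by (rule mult_right_mono) simp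
    finally show "real (card ?B) \<le> 1 / 2 * (real ?N)\<^sup>2" .
  qed simp
  also have "(1 / 2 * (real ?N)\<^sup>2) * real ?N ^ (?r - 2) = real ?N ^ ?r / 2"
  proof -
    have "(real ?N)\<^sup>2 * real ?N ^ (?r - 2) = real ?N ^ ?r"
      by (simp only: power_add[symmetric] le_add_diff_inverse[OF A(2)])
    then show ?thesis by (simp only: mult.assoc)
  qed
  finally show ?thesis by simp
qed

section \<open>The probability of purity\<close>

lemma card_pure_labelled:
  assumes A: "finite A" and n: "n > 0"
  shows "real (card {E \<in> labelled_graphs A n. pure_subgroup (loops E 0) A})
    \<le> (exp 1 / sqrt n * real (card (partial_injections {..<n}))) ^ card A"
proof -
  let ?X = "{R \<in> partial_injections {..<n}. only_fixed_cycles R}"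
  have finX: "finite ?X" using finite_partial_injections[of "{..<n}"] by simp
  have "{E \<in> labelled_graphs A n. pure_subgroup (loops E 0) A} \<subseteq>
      {E. A_graph A {..<n} E \<and> (\<forall>a\<in>A. letter_rel E a \<in> ?X)}" (is "_ \<subseteq> ?G")
    using pure_no_long_cycle letter_rel_partial_injection admissible_A_graph
    by (fastforce simp: labelled_graphs_def only_fixed_cycles_def)
  then have "card {E \<in> labelled_graphs A n. pure_subgroup (loops E 0) A} \<le> card ?G"
    using finite_A_graphs[OF A, of "{..<n}"] by (intro card_mono) auto
  also have "\<dots> \<le> card ?X ^ card A" by (rule card_A_graphs_letterwise[OF A finX])
  finally have "real (card {E \<in> labelled_graphs A n. pure_subgroup (loops E 0) A}) \<le> real (card ?X ^ card A)"
    by (simp only: of_nat_le_iff)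
  also have "\<dots> = real (card ?X) ^ card A" by simp
  also have "\<dots> \<le> (exp 1 / sqrt n * real (card (partial_injections {..<n}))) ^ card A"
    using card_only_fixed_cycles[of "{..<n}"] n by (intro power_mono) auto
  finally show ?thesis .
qed

text \<open>The factors \<open>(n - 1)!\<close> cancel in the quotient of the numbers of pure and of all subgroups, which leaves
numbers of labelled graphs.\<close>

lemma prob_pure_bound:
  assumes A: "finite A" "card A \<ge> 2" and n: "n > 0" and large: "bad_pair_const / sqrt n \<le> 1 / 2"
  shows "measure_pmf.prob (pmf_of_set (subgroups_of_size A n)) {H. pure_subgroup H A}
    \<le> 2 * exp 1 ^ card A * real n powr (- real (card A) / 2)"
proof -
  let ?S = "subgroups_of_size A n" and ?r = "card A"
  let ?N = "real (card (partial_injections {..<n}))"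
  let ?P = "{E \<in> labelled_graphs A n. pure_subgroup (loops E 0) A}"
  have "?N \<ge> 1"
    using card_partial_injections[of "{..<n}"] injection_coeff_ge_1[of n] mult_mono[OF fact_ge_1[of n] injection_coeff_ge_1[of n]]
    by simp
  then have N: "?N ^ ?r / 2 > 0" by simp
  note low = card_labelled_lower[OF A n large]
  have cS: "card (labelled_graphs A n) = fact (n - 1) * card ?S"
    using card_labelled_property[OF A(1), of n "\<lambda>_. True"] by simp
  have cP: "card ?P = fact (n - 1) * card {H \<in> ?S. pure_subgroup H A}"
    by (rule card_labelled_property[OF A(1)])
  have pos: "card (labelled_graphs A n) > 0" using low N by linarith
  with cS have "card ?S > 0" by simp
  then have S: "?S \<noteq> {}" "finite ?S" by (auto simp: card_gt_0_iff)
  have "measure_pmf.prob (pmf_of_set ?S) {H. pure_subgroup H A} =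
      real (card {H \<in> ?S. pure_subgroup H A}) / real (card ?S)"
    using measure_pmf_of_set[OF S, of "{H. pure_subgroup H A}"] by (simp add: Int_def)
  also have "\<dots> = real (card ?P) / real (card (labelled_graphs A n))"
    unfolding cS cP by simp
  also have "\<dots> \<le> (exp 1 / sqrt n * ?N) ^ ?r / (?N ^ ?r / 2)"
    by (rule frac_le[OF _ card_pure_labelled[OF A(1) n] N low]) simp
  also have "\<dots> = 2 * exp 1 ^ ?r * (1 / sqrt n) ^ ?r"
  proof -
    have "exp 1 / sqrt n * ?N = exp 1 * (1 / sqrt n) * ?N" by simp
    then have eq: "(exp 1 / sqrt n * ?N) ^ ?r = exp 1 ^ ?r * (1 / sqrt n) ^ ?r * ?N ^ ?r"
      by (simp only: power_mult_distrib)
    have cancel: "x * y / (y / 2) = 2 * x" if "y \<noteq> 0" for x y :: real using that by simp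
    have ne: "?N ^ ?r \<noteq> 0" using N by linarith
    show ?thesis unfolding eq cancel[OF ne] by (simp only: mult.assoc)
  qed
  also have "(1 / sqrt n) ^ ?r = real n powr (- real ?r / 2)"
  proof -
    have "1 / sqrt n = real n powr (- (1/2))"
      by (simp only: powr_minus powr_half_sqrt[OF of_nat_0_le_iff] inverse_eq_divide)
    then have "(1 / sqrt n) ^ ?r = (real n powr (- (1/2))) ^ ?r" by (simp only:)
    also have "\<dots> = (real n powr (- (1/2))) powr real ?r"
      by (rule powr_realpow[symmetric]) (use n in simp)
    also have "\<dots> = real n powr (- (1/2) * real ?r)" by (rule powr_powr)
    also have "- (1/2) * real ?r = - real ?r / 2" by simp
    finally show ?thesis .
  qed
  finally show ?thesis .
qed

theorem theorem4p7:
  fixes A :: "'a set" and r :: nat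
  assumes "finite A" and "card A = r" and "r \<ge> 2"
  shows "(\<lambda>n. measure_pmf.prob (pmf_of_set (subgroups_of_size A n)) {H. pure_subgroup H A})
           \<in> O(\<lambda>n. real n powr (- real r / 2))"
proof (rule bigoI)
  have "(\<lambda>n. bad_pair_const / sqrt (real n)) \<longlonglongrightarrow> 0"
    by (intro tendsto_divide_0[OF tendsto_const] filterlim_at_top_imp_at_infinity
        filterlim_compose[OF sqrt_at_top filterlim_real_sequentially])
  then have "\<forall>\<^sub>F n in sequentially. bad_pair_const / sqrt (real n) < 1 / 2"
    by (rule order_tendstoD) simp
  moreover have "\<forall>\<^sub>F n in sequentially. n > 0" by (rule eventually_gt_at_top)
  ultimately show "\<forall>\<^sub>F n in sequentially.
      norm (measure_pmf.prob (pmf_of_set (subgroups_of_size A n)) {H. pure_subgroup H A})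
      \<le> (2 * exp 1 ^ r) * norm (real n powr (- real r / 2))"
  proof eventually_elim
    case (elim n)
    then show ?case using prob_pure_bound[of A n] assms by simp
  qed
qed

end
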